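(* Assume $\mathcal H_\delta(U,V)$ (defined in the context) is satisfied for some $\delta\in(0,1]$, and let $(\varphi,\psi)=(e^{\delta U},e^{\delta V})$. Then there exist $n_0\ge0$, $\rho\in[0,1)$ and $c_1,c_2\ge0$ such that for any $n\ge n_0$ $$\|\pi_{2n}-\nu_V\|_{tv}\le c_1|||\pi_{2n}-\nu_V|||_\psi\le c_2\,\rho^{n-n_0}|||\pi_{2n_0}-\nu_V|||_\psi,$$ $$\|\pi_{2n+1}-\lambda_U\|_{tv}\le c_1|||\pi_{2n+1}-\lambda_U|||_\varphi\le c_2\,\rho^{n-n_0}|||\pi_{2n_0+1}-\lambda_U|||_\varphi.$$
   Context: Setting. $(\mathbb X,\lambda)$ and $(\mathbb Y,\nu)$ are locally compact Polish spaces with positive measures $\lambda,\nu$ that are finite on compact sets. $U:\mathbb X\to\mathbb R$, $V:\mathbb Y\to\mathbb R$, $W:\mathbb X\times\mathbb Y\to\mathbb R$ are measurable, such that $\lambda_U(dx):=e^{-U(x)}\lambda(dx)$ and $\nu_V(dy):=e^{-V(y)}\nu(dy)$ are probability measures and $Q(x,dy):=e^{-W(x,y)}\nu(dy)$ is a Markov kernel; more generally $\lambda_F(dx)=e^{-F(x)}\lambda(dx)$, $\nu_G(dy)=e^{-G(y)}\nu(dy)$. Put $R(y,dx):=e^{-W(x,y)}\lambda(dx)$. Integrated costs: $W_U(y)=\int\lambda_U(dx)W(x,y)$, $W^V(x)=\int\nu_V(dy)W(x,y)$. For a kernel $K$, $K(f)(x)=\int K(x,dy)f(y)$ and $(\mu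 K)(dy)=\int\mu(dx)K(x,dy)$. Standing assumption: some probability measure with marginals $\lambda_U,\nu_V$ has finite relative entropy with respect to $\lambda_U(dx)Q(x,dy)$. Standing regularity: $U,V,W$ are locally bounded (bounded on compact sets), $e^{-W}\in L_\infty(\lambda\otimes\nu)$, and $U,V$ have compact sub-level sets. Condition $\mathcal H_\delta(U,V)$: the functions $\mathcal U_\delta=\delta U-W^V$ and $\mathcal V_\delta=\delta V-W_U$ are locally bounded with compact sub-level sets, and $\lambda_{(1-\delta)U}(e^{W^V})\vee\nu_{(1-\delta)V}(e^{W_U})<\infty$. Sinkhorn iterations. $U_0=U$, $V_0=0$, and for $n\ge0$: $U_{2n+1}=U_{2n}=U+\log Q(e^{-V_{2n}})$, $V_{2(n+1)}=V_{2n+1}=V+\log R(e^{-U_{2n}})$; $$S_{2n}(x,dy)=\frac{Q(x,dy)e^{-V_{2n}(y)}}{Q(e^{-V_{2n}})(x)},\qquad S_{2n+1}(y,dx)=\frac{R(y,dx)e^{-U_{2n+1}(x)}}{R(e^{-U_{2n+1}})(y)};$$ $\pi_{2n}=\lambda_US_{2n}$, $\pi_{2n+1}=\nu_VS_{2n+1}$. Norms: $|||\mu|||_\theta=\int\theta\,d|\mu|$, $\|\mu_1-\mu_2\|_{tv}=\tfrac12|\mu_1-\mu_2|(1)$. *)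

theory Defs
  imports "HOL-Probability.Probability"
begin

section \<open>Regularity of functions and measures\<close>

definition finite_on_compacts :: "'a::topological_space measure \<Rightarrow> bool" where
  "finite_on_compacts M \<longleftrightarrow> (\<forall>K. compact K \<longrightarrow> emeasure M K < \<infinity>)"

definition locally_bounded :: "('a::topological_space \<Rightarrow> real) \<Rightarrow> bool" where
  "locally_bounded f \<longleftrightarrow> (\<forall>K. compact K \<longrightarrow> bounded (f ` K))"

definition compact_sublevels :: "('a::topological_space \<Rightarrow> real) \<Rightarrow> bool" where
  "compact_sublevels f \<longleftrightarrow> (\<forall>r. compact {x. f x \<le> r})"

definition essentially_bounded :: "'a measure \<Rightarrow> ('a \<Rightarrow> real) \<Rightarrow> bool" where
  "essentially_bounded M f \<longleftrightarrow> f \<in> borel_measurable M \<and> (\<exists>C. AE x in M. \<bar>f x\<bar> \<le> C)"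


section \<open>Gibbs measures, kernels, integrated costs\<close>

text \<open>The reference measure on the first space, usually called \<open>\<lambda>\<close>, is written \<open>\<Lambda>\<close>
  because \<open>\<lambda>\<close> is reserved for abstraction.\<close>

definition gibbs :: "'a measure \<Rightarrow> ('a \<Rightarrow> real) \<Rightarrow> 'a measure" where
  "gibbs M F = density M (\<lambda>x. ennreal (exp (- F x)))"

definition kernel_Q :: "'b measure \<Rightarrow> ('a \<Rightarrow> 'b \<Rightarrow> real) \<Rightarrow> 'a \<Rightarrow> 'b measure" where
  "kernel_Q \<nu> W x = density \<nu> (\<lambda>y. ennreal (exp (- W x y)))"

definition kernel_R :: "'a measure \<Rightarrow> ('a \<Rightarrow> 'b \<Rightarrow> real) \<Rightarrow> 'b \<Rightarrow> 'a measure" where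
  "kernel_R \<Lambda> W y = density \<Lambda> (\<lambda>x. ennreal (exp (- W x y)))"

definition kernel_apply :: "('a \<Rightarrow> 'b measure) \<Rightarrow> ('b \<Rightarrow> real) \<Rightarrow> 'a \<Rightarrow> real" where
  "kernel_apply K f x = (\<integral>y. f y \<partial>K x)"

text \<open>The integrated costs \<open>W_U\<close> and \<open>W^V\<close>.  These are Bochner integrals, with value 0 on
  non-integrable sections; integrability of all sections is part of \<open>H_cond\<close> below.\<close>

definition cost_U :: "'a measure \<Rightarrow> ('a \<Rightarrow> real) \<Rightarrow> ('a \<Rightarrow> 'b \<Rightarrow> real) \<Rightarrow> 'b \<Rightarrow> real" where
  "cost_U \<Lambda> U W y = (\<integral>x. W x y \<partial>gibbs \<Lambda> U)"

definition cost_V :: "'b measure \<Rightarrow> ('b \<Rightarrow> real) \<Rightarrow> ('a \<Rightarrow> 'b \<Rightarrow> real) \<Rightarrow> 'a \<Rightarrow> real" where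
  "cost_V \<nu> V W x = (\<integral>y. W x y \<partial>gibbs \<nu> V)"

text \<open>The joint measure \<open>\<mu>(dx) K(x,dy)\<close>.\<close>

definition semidirect :: "'a::topological_space measure \<Rightarrow> ('a \<Rightarrow> 'b::topological_space measure) \<Rightarrow> ('a \<times> 'b) measure" where
  "semidirect \<mu> K = bind \<mu> (\<lambda>x. distr (K x) (borel \<Otimes>\<^sub>M borel) (Pair x))"

text \<open>For probability measures the negative part of \<open>ln (dP/dM)\<close> is always \<open>P\<close>-integrable, so
  integrability of the logarithmic density is exactly finiteness of the relative entropy of \<open>P\<close>
  with respect to \<open>M\<close>.\<close>

definition finite_relative_entropy :: "'a measure \<Rightarrow> 'a measure \<Rightarrow> bool" where
  "finite_relative_entropy P M \<longleftrightarrow>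
     absolutely_continuous M P \<and> integrable P (entropy_density (exp 1) M P)"

definition finite_entropy_coupling ::
  "'a::topological_space measure \<Rightarrow> 'b::topological_space measure \<Rightarrow> ('a \<Rightarrow> 'b measure) \<Rightarrow> bool" where
  "finite_entropy_coupling \<mu> \<eta> Q \<longleftrightarrow>
     (\<exists>P. sets P = sets (borel \<Otimes>\<^sub>M borel) \<and> prob_space P \<and>
          distr P borel fst = \<mu> \<and> distr P borel snd = \<eta> \<and>
          finite_relative_entropy P (semidirect \<mu> Q))"


section \<open>The condition \<open>H_\<delta>(U,V)\<close>\<close>

text \<open>The two integrability clauses say that \<open>W^V\<close> and \<open>W_U\<close> are finite everywhere, which is
  implicit in \<open>\<delta>U - W^V\<close> and \<open>\<delta>V - W_U\<close> being (real-valued) locally bounded functions.\<close>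

definition H_cond ::
  "'a::topological_space measure \<Rightarrow> 'b::topological_space measure \<Rightarrow> ('a \<Rightarrow> real) \<Rightarrow> ('b \<Rightarrow> real)
     \<Rightarrow> ('a \<Rightarrow> 'b \<Rightarrow> real) \<Rightarrow> real \<Rightarrow> bool" where
  "H_cond \<Lambda> \<nu> U V W \<delta> \<longleftrightarrow>
     (\<forall>x. integrable (gibbs \<nu> V) (\<lambda>y. W x y)) \<and>
     (\<forall>y. integrable (gibbs \<Lambda> U) (\<lambda>x. W x y)) \<and>
     locally_bounded (\<lambda>x. \<delta> * U x - cost_V \<nu> V W x) \<and>
     compact_sublevels (\<lambda>x. \<delta> * U x - cost_V \<nu> V W x) \<and>
     locally_bounded (\<lambda>y. \<delta> * V y - cost_U \<Lambda> U W y) \<and>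
     compact_sublevels (\<lambda>y. \<delta> * V y - cost_U \<Lambda> U W y) \<and>
     max (\<integral>\<^sup>+x. ennreal (exp (cost_V \<nu> V W x)) \<partial>gibbs \<Lambda> (\<lambda>x. (1 - \<delta>) * U x))
         (\<integral>\<^sup>+y. ennreal (exp (cost_U \<Lambda> U W y)) \<partial>gibbs \<nu> (\<lambda>y. (1 - \<delta>) * V y)) < \<infinity>"


section \<open>Sinkhorn iterations\<close>

text \<open>The pair \<open>(U\<^sub>n, V\<^sub>n)\<close>.  The step from \<open>2m\<close> to \<open>2m+1\<close> updates \<open>V\<close>, the step from
  \<open>2m+1\<close> to \<open>2m+2\<close> updates \<open>U\<close>; the defining equations of the iteration are
  \<open>pot_even\<close>, \<open>pot_odd\<close> below.\<close>

primrec sinkhorn_pot ::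
  "'a measure \<Rightarrow> 'b measure \<Rightarrow> ('a \<Rightarrow> real) \<Rightarrow> ('b \<Rightarrow> real) \<Rightarrow> ('a \<Rightarrow> 'b \<Rightarrow> real)
     \<Rightarrow> nat \<Rightarrow> ('a \<Rightarrow> real) \<times> ('b \<Rightarrow> real)" where
  "sinkhorn_pot \<Lambda> \<nu> U V W 0 = (U, \<lambda>_. 0)"
| "sinkhorn_pot \<Lambda> \<nu> U V W (Suc n) =
     (let (u, v) = sinkhorn_pot \<Lambda> \<nu> U V W n in
      if even n
      then (u, \<lambda>y. V y + ln (kernel_apply (kernel_R \<Lambda> W) (\<lambda>x. exp (- u x)) y))
      else (\<lambda>x. U x + ln (kernel_apply (kernel_Q \<nu> W) (\<lambda>y. exp (- v y)) x), v))"

definition pot_U where "pot_U \<Lambda> \<nu> U V W n = fst (sinkhorn_pot \<Lambda> \<nu> U V W n)"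
definition pot_V where "pot_V \<Lambda> \<nu> U V W n = snd (sinkhorn_pot \<Lambda> \<nu> U V W n)"

lemma pot_0: "pot_U \<Lambda> \<nu> U V W 0 = U" "pot_V \<Lambda> \<nu> U V W 0 = (\<lambda>_. 0)"
  by (simp_all add: pot_U_def pot_V_def)

lemma pot_odd:
  "pot_U \<Lambda> \<nu> U V W (2 * n + 1) = pot_U \<Lambda> \<nu> U V W (2 * n)"
  "pot_V \<Lambda> \<nu> U V W (2 * (n + 1)) = pot_V \<Lambda> \<nu> U V W (2 * n + 1)"
  "pot_V \<Lambda> \<nu> U V W (2 * n + 1) =
     (\<lambda>y. V y + ln (kernel_apply (kernel_R \<Lambda> W) (\<lambda>x. exp (- pot_U \<Lambda> \<nu> U V W (2 * n) x)) y))"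
  by (simp_all add: pot_U_def pot_V_def split_beta Let_def)

lemma pot_even:
  assumes "\<And>x. prob_space (kernel_Q \<nu> W x)"
  shows "pot_U \<Lambda> \<nu> U V W (2 * n) =
     (\<lambda>x. U x + ln (kernel_apply (kernel_Q \<nu> W) (\<lambda>y. exp (- pot_V \<Lambda> \<nu> U V W (2 * n) y)) x))"
proof (cases n)
  case 0
  have "measure (kernel_Q \<nu> W x) (space (kernel_Q \<nu> W x)) = 1" for x
    using assms prob_space.prob_space by blast
  then show ?thesis using 0 by (simp add: pot_0 kernel_apply_def)
qed (simp add: pot_U_def pot_V_def split_beta Let_def)

text \<open>\<open>K(x,dy) e\<^bsup>-f(y)\<^esup> / K(e\<^bsup>-f\<^esup>)(x)\<close>.  Where \<open>e\<^bsup>-f\<^esup>\<close> is not \<open>K x\<close>-integrable this is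
  the zero measure, so a bridge is always a sub-Markov kernel.\<close>

definition bridge :: "('a \<Rightarrow> 'b measure) \<Rightarrow> ('b \<Rightarrow> real) \<Rightarrow> 'a \<Rightarrow> 'b measure" where
  "bridge K f x =
     density (K x) (\<lambda>y. ennreal (exp (- f y) / kernel_apply K (\<lambda>y. exp (- f y)) x))"

definition S_even where
  "S_even \<Lambda> \<nu> U V W n = bridge (kernel_Q \<nu> W) (pot_V \<Lambda> \<nu> U V W (2 * n))"

definition S_odd where
  "S_odd \<Lambda> \<nu> U V W n = bridge (kernel_R \<Lambda> W) (pot_U \<Lambda> \<nu> U V W (2 * n + 1))"

text \<open>\<open>pi_even n\<close> is \<open>\<pi>\<close> with index \<open>2n\<close>, \<open>pi_odd n\<close> is \<open>\<pi>\<close> with index \<open>2n+1\<close>.\<close>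

definition pi_even ::
  "'a measure \<Rightarrow> 'b measure \<Rightarrow> ('a \<Rightarrow> real) \<Rightarrow> ('b \<Rightarrow> real) \<Rightarrow> ('a \<Rightarrow> 'b \<Rightarrow> real) \<Rightarrow> nat \<Rightarrow> 'b measure" where
  "pi_even \<Lambda> \<nu> U V W n = bind (gibbs \<Lambda> U) (S_even \<Lambda> \<nu> U V W n)"

definition pi_odd ::
  "'a measure \<Rightarrow> 'b measure \<Rightarrow> ('a \<Rightarrow> real) \<Rightarrow> ('b \<Rightarrow> real) \<Rightarrow> ('a \<Rightarrow> 'b \<Rightarrow> real) \<Rightarrow> nat \<Rightarrow> 'a measure" where
  "pi_odd \<Lambda> \<nu> U V W n = bind (gibbs \<nu> V) (S_odd \<Lambda> \<nu> U V W n)"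


section \<open>Total variation and weighted norms\<close>

text \<open>The total variation measure \<open>|\<mu>\<^sub>1 - \<mu>\<^sub>2|\<close> of the difference of two finite measures on the
  same sigma-algebra.\<close>

definition variation_diff :: "'a measure \<Rightarrow> 'a measure \<Rightarrow> 'a measure" where
  "variation_diff M N = measure_of (space M) (sets M)
     (\<lambda>A. SUP P \<in> {P. finite P \<and> partition_on A P \<and> P \<subseteq> sets M}.
            \<Sum>B\<in>P. ennreal \<bar>measure M B - measure N B\<bar>)"

definition weighted_dist :: "('a \<Rightarrow> real) \<Rightarrow> 'a measure \<Rightarrow> 'a measure \<Rightarrow> ennreal" where
  "weighted_dist \<theta> M N = (\<integral>\<^sup>+x. ennreal (\<theta> x) \<partial>variation_diff M N)"

definition tv_dist :: "'a measure \<Rightarrow> 'a measure \<Rightarrow> ennreal" where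
  "tv_dist M N = emeasure (variation_diff M N) (space M) / 2"

end

theory Submission
  imports Defs
begin

text \<open>
  All potentials are taken relative to the Gibbs measures \<open>M = gibbs \<Lambda> U\<close> and \<open>N = gibbs \<nu> V\<close>: with
  \<open>a n = U\<^sub>2\<^sub>n - U\<close> and \<open>b n = V\<^sub>2\<^sub>n - V\<close> the iteration becomes the symmetric pair of entropic transforms
  \<open>a n = ln (\<integral> exp (- W - b n) dN)\<close> and \<open>b (n + 1) = ln (\<integral> exp (- W - a n) dM)\<close>.  The marginals then have the densities
  \<open>exp (b (n + 1) - b n)\<close> with respect to \<open>N\<close> and \<open>exp (a (n + 1) - a n)\<close> with respect to \<open>M\<close>
  (lemma \<open>bridge_marginal\<close>), and the errors, densities minus one, are carried from one space to the other,
  up to sign, by the Markov kernels \<open>exp (- W - a n - b (n + 1))\<close> and \<open>exp (- W - a (n + 1) - b (n + 1))\<close>.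
  As the errors have mean zero, convergence is a matter of contraction of these kernels in weighted norms, uniformly
  in \<open>n\<close>.

  Each kernel contracts by Harris' argument from a drift and a minorisation bound (\<open>weighted_contraction\<close>).
  Both bounds follow from \<open>- W^V - c \<le> a n \<le> c\<close> and \<open>- W_U - c \<le> b (n + 1) \<le> c\<close> for all \<open>n\<close>
  with one constant \<open>c\<close> (\<open>sinkhorn_potentials_bounded\<close>).  The lower bounds are Jensen's inequality, uniform because the means of the potentials
  never increase along the iteration; they imply the upper bounds because \<open>exp W_U\<close> and \<open>exp W^V\<close> are integrable and
  \<open>W\<close> is essentially bounded below.  Given these bounds, the integral of \<open>\<phi>\<close> against the kernel
  from \<open>N\<close> to \<open>M\<close> is at most a multiple of \<open>exp W_U\<close>.
  Since \<open>\<delta> V - W_U\<close> has compact sublevel sets, this is at most \<open>\<psi> / 4\<close> plus a constant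
  (\<open>half_step_drift\<close>); and as \<open>W\<close> is bounded on products of compact sublevel sets of \<open>U\<close> and \<open>V\<close>, the kernels
  are bounded below there.  The other direction is obtained by exchanging the spaces.

  The index from which the estimates hold is \<open>n\<^sub>0 = 1\<close>: the density \<open>exp (b 1 - b 0) = exp (b 1 + V)\<close> of the
  initial marginal need not have a finite \<open>\<psi>\<close>-moment, while for \<open>n \<ge> 1\<close> the density is dominated by a multiple of
  \<open>exp W_U\<close>, whose \<open>\<psi>\<close>-moment is finite.
\<close>

section \<open>Weighted contraction of kernels\<close>

text \<open>The quantitative Harris argument, for functions \<open>f\<close> of mean zero instead of signed measures.
  The small set is \<open>\<psi> \<le> 16 C\<close>, where the kernel dominates \<open>\<kappa>\<close> times the indicator of \<open>K\<close>: removing this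
  common part costs nothing because \<open>f\<close> has mean zero, and it saves the fraction \<open>\<alpha>\<close> of the unweighted mass,
  up to an error \<open>\<alpha> \<integral>\<bar>f\<bar>\<psi> / (8 C)\<close> from outside the small set.  The drift bound shrinks the weighted mass
  by 4 at the price of \<open>C \<integral>\<bar>f\<bar>\<close>.  With \<open>\<beta> = \<alpha> / (2 C)\<close> both errors are absorbed: the unweighted part
  retains \<open>1 - \<alpha> + \<beta> C = 1 - \<alpha>/2\<close>, and the weighted part \<open>\<alpha> / (8 C) + \<beta> / 4 = \<beta> / 2 \<le> (1 - \<alpha>/2) \<beta>\<close>.
  The threshold and \<open>C\<close> do not involve \<open>\<alpha>\<close>, which may depend on both.\<close>

lemma weighted_contraction:
  fixes k :: "'a \<Rightarrow> 'b \<Rightarrow> real"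
  assumes M: "finite_measure M" and N: "sigma_finite_measure N"
    and k[measurable]: "case_prod k \<in> borel_measurable (M \<Otimes>\<^sub>M N)" and k0: "\<And>x y. 0 \<le> k x y"
    and \<phi>[measurable]: "\<phi> \<in> borel_measurable M" and \<phi>0: "\<And>x. 0 \<le> \<phi> x"
    and \<psi>[measurable]: "\<psi> \<in> borel_measurable N" and \<psi>0: "\<And>y. 0 \<le> \<psi> y"
    and f: "integrable N f" and f\<psi>: "integrable N (\<lambda>y. \<bar>f y\<bar> * \<psi> y)" and f_mean: "(\<integral>y. f y \<partial>N) = 0"
    and g[measurable]: "g \<in> borel_measurable M" and g_eq: "AE x in M. \<bar>g x\<bar> = \<bar>\<integral>y. k x y * f y \<partial>N\<bar>"
    and mass: "AE y in N. (\<integral>\<^sup>+x. k x y \<partial>M) \<le> 1"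
    and drift: "AE y in N. (\<integral>\<^sup>+x. k x y * \<phi> x \<partial>M) \<le> ennreal (\<psi> y / 4 + C)"
    and K[measurable]: "K \<in> sets M" and \<kappa>: "0 \<le> \<kappa>"
    and minor: "AE x in M. x \<in> K \<longrightarrow> (AE y in N. \<psi> y \<le> 16 * C \<longrightarrow> \<kappa> \<le> k x y)"
    and \<alpha>: "\<alpha> = \<kappa> * measure M K" "0 < \<alpha>" "\<alpha> \<le> 1" and C: "0 < C" and \<beta>: "\<beta> = \<alpha> / (2 * C)"
  shows "(\<integral>\<^sup>+x. ennreal (\<bar>g x\<bar> * (1 + \<beta> * \<phi> x)) \<partial>M)
    \<le> ennreal (1 - \<alpha> / 2) * (\<integral>\<^sup>+y. ennreal (\<bar>f y\<bar> * (1 + \<beta> * \<psi> y)) \<partial>N)"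
proof -
  interpret M: finite_measure M by (fact M)
  interpret N: sigma_finite_measure N by (fact N)
  interpret P: pair_sigma_finite M N ..
  have [measurable]: "f \<in> borel_measurable N" using f by auto
  define n where "n = (\<integral>y. \<bar>f y\<bar> \<partial>N)"
  define p where "p = (\<integral>y. \<bar>f y\<bar> * \<psi> y \<partial>N)"
  have n0: "0 \<le> n" and p0: "0 \<le> p" using \<psi>0 by (auto simp: n_def p_def)
  have \<beta>0: "0 \<le> \<beta>" using \<alpha> C \<beta> by auto
  have n_nn: "(\<integral>\<^sup>+y. ennreal \<bar>f y\<bar> \<partial>N) = ennreal n"
    unfolding n_def using f by (intro nn_integral_eq_integral) auto
  have p_nn: "(\<integral>\<^sup>+y. ennreal (\<bar>f y\<bar> * \<psi> y) \<partial>N) = ennreal p"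
    unfolding p_def using f\<psi> \<psi>0 by (intro nn_integral_eq_integral) auto
  define F where "F x = (\<integral>\<^sup>+y. ennreal (k x y * \<bar>f y\<bar>) \<partial>N)" for x
  have Fm[measurable]: "F \<in> borel_measurable M" unfolding F_def by measurable
  have F_le: "(\<integral>\<^sup>+x. F x \<partial>M) \<le> ennreal n"
  proof -
    have "(\<integral>\<^sup>+x. F x \<partial>M) = (\<integral>\<^sup>+y. \<integral>\<^sup>+x. ennreal (k x y * \<bar>f y\<bar>) \<partial>M \<partial>N)"
      unfolding F_def by (rule P.Fubini'[symmetric]) measurable
    also have "\<dots> = (\<integral>\<^sup>+y. (\<integral>\<^sup>+x. ennreal (k x y) \<partial>M) * ennreal \<bar>f y\<bar> \<partial>N)"
      by (intro nn_integral_cong) (simp add: ennreal_mult k0 nn_integral_multc)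
    also have "\<dots> \<le> (\<integral>\<^sup>+y. 1 * ennreal \<bar>f y\<bar> \<partial>N)"
      using mass by (intro nn_integral_mono_AE) (auto elim!: eventually_mono intro!: mult_right_mono simp del: mult_1)
    finally show ?thesis by (simp add: n_nn)
  qed
  have F_fin: "AE x in M. F x \<noteq> \<infinity>"
    by (rule nn_integral_PInf_AE) (use F_le in \<open>auto simp: top_unique\<close>)
  \<comment> \<open>Since \<open>f\<close> has mean zero, \<open>k\<close> may be replaced by \<open>k - \<kappa>\<close>, and
    \<open>\<bar>k - \<kappa>\<bar> \<le> k - \<kappa> + 2\<kappa> \<psi> / (16 C)\<close> holds on \<open>K\<close> whether or not \<open>\<psi> \<le> 16 C\<close>.\<close>
  have pointwise: "AE x in M. ennreal \<bar>g x\<bar> + ennreal (\<kappa> * n * indicator K x)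
      \<le> F x + ennreal (\<kappa> * p / (8 * C) * indicator K x)"
    using F_fin g_eq minor AE_space
  proof eventually_elim
    case (elim x)
    have kx[measurable]: "k x \<in> borel_measurable N"
      using measurable_Pair2[OF k, of x] elim(4) by simp
    have int: "integrable N (\<lambda>y. k x y * \<bar>f y\<bar>)"
      using elim(1) k0 by (intro integrableI_nonneg) (auto simp: F_def less_top)
    then have int': "integrable N (\<lambda>y. k x y * f y)"
      by (rule Bochner_Integration.integrable_bound) (auto simp: abs_mult k0)
    have Fx: "F x = ennreal (\<integral>y. k x y * \<bar>f y\<bar> \<partial>N)"
      unfolding F_def using int k0 by (intro nn_integral_eq_integral) auto
    have Fx0: "0 \<le> (\<integral>y. k x y * \<bar>f y\<bar> \<partial>N)" using k0 by (intro integral_nonneg_AE) auto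
    have "\<bar>g x\<bar> + \<kappa> * n * indicator K x \<le> (\<integral>y. k x y * \<bar>f y\<bar> \<partial>N) + \<kappa> * p / (8 * C) * indicator K x"
    proof (cases "x \<in> K")
      case False
      then show ?thesis using elim(2) integral_abs_bound[of N "\<lambda>y. k x y * f y"]
        by (simp add: abs_mult k0)
    next
      case True
      have "(\<integral>y. k x y * f y \<partial>N) = (\<integral>y. k x y * f y \<partial>N) - \<kappa> * (\<integral>y. f y \<partial>N)"
        by (simp add: f_mean)
      also have "\<dots> = (\<integral>y. k x y * f y - \<kappa> * f y \<partial>N)" using int' f by simp
      also have "\<bar>\<dots>\<bar> \<le> (\<integral>y. \<bar>k x y * f y - \<kappa> * f y\<bar> \<partial>N)" by (rule integral_abs_bound)
      also have "\<dots> \<le> (\<integral>y. k x y * \<bar>f y\<bar> - \<kappa> * \<bar>f y\<bar> + \<kappa> / (8 * C) * (\<bar>f y\<bar> * \<psi> y) \<partial>N)"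
      proof (rule integral_mono_AE)
        show "AE y in N. \<bar>k x y * f y - \<kappa> * f y\<bar> \<le> k x y * \<bar>f y\<bar> - \<kappa> * \<bar>f y\<bar> + \<kappa> / (8 * C) * (\<bar>f y\<bar> * \<psi> y)"
          using elim(3)[rule_format, OF True]
        proof eventually_elim
          case (elim y)
          have "\<bar>k x y - \<kappa>\<bar> \<le> k x y - \<kappa> + \<kappa> / (8 * C) * \<psi> y"
          proof (cases "\<psi> y \<le> 16 * C")
            case True
            then show ?thesis using elim \<kappa> C \<psi>0[of y] by (simp add: abs_if)
          next
            case False
            then have "2 \<le> \<psi> y / (8 * C)" using C by (simp add: field_simps)
            then have "\<kappa> * 2 \<le> \<kappa> * (\<psi> y / (8 * C))" using \<kappa> by (intro mult_left_mono)
            then show ?thesis using k0[of x y] \<kappa> by (simp add: abs_if)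
          qed
          then have "\<bar>k x y - \<kappa>\<bar> * \<bar>f y\<bar> \<le> (k x y - \<kappa> + \<kappa> / (8 * C) * \<psi> y) * \<bar>f y\<bar>"
            by (rule mult_right_mono) simp
          then show ?case by (simp add: abs_mult[symmetric] algebra_simps)
        qed
      qed (use int int' f f\<psi> in auto)
      also have "\<dots> = (\<integral>y. k x y * \<bar>f y\<bar> \<partial>N) - \<kappa> * n + \<kappa> / (8 * C) * p"
        using int f f\<psi> by (simp add: n_def p_def)
      finally show ?thesis using True elim(2) by simp
    qed
    then have "ennreal (\<bar>g x\<bar> + \<kappa> * n * indicator K x)
        \<le> ennreal ((\<integral>y. k x y * \<bar>f y\<bar> \<partial>N) + \<kappa> * p / (8 * C) * indicator K x)"
      by (rule ennreal_leI)
    then show ?case unfolding Fx using Fx0 \<kappa> n0 p0 C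
      by (subst (asm) (1 2) ennreal_plus) (auto intro!: mult_nonneg_nonneg)
  qed
  define X where "X = (\<integral>\<^sup>+x. ennreal \<bar>g x\<bar> \<partial>M)"
  define Y where "Y = (\<integral>\<^sup>+x. ennreal (\<bar>g x\<bar> * \<phi> x) \<partial>M)"
  have K_int: "(\<integral>\<^sup>+x. ennreal (c * indicator K x) \<partial>M) = ennreal (c * measure M K)" if "0 \<le> c" for c
    using that by (simp add: ennreal_mult nn_integral_cmult ennreal_indicator M.emeasure_eq_measure)
  have "X + ennreal (\<alpha> * n) = (\<integral>\<^sup>+x. ennreal \<bar>g x\<bar> + ennreal (\<kappa> * n * indicator K x) \<partial>M)"
    using K_int[of "\<kappa> * n"] \<kappa> n0 by (subst nn_integral_add) (auto simp: X_def \<alpha>(1) mult.commute mult.left_commute)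
  also have "\<dots> \<le> (\<integral>\<^sup>+x. F x + ennreal (\<kappa> * p / (8 * C) * indicator K x) \<partial>M)"
    by (rule nn_integral_mono_AE) (rule pointwise)
  also have "\<dots> = (\<integral>\<^sup>+x. F x \<partial>M) + ennreal (\<kappa> * p / (8 * C) * measure M K)"
    using \<kappa> p0 C by (subst nn_integral_add) (auto simp del: times_divide_eq_left simp: K_int)
  also have "\<dots> \<le> ennreal n + ennreal (\<alpha> * p / (8 * C))"
    using F_le by (intro add_mono) (auto simp: \<alpha>(1) mult_ac)
  also have "\<dots> = ennreal (n + \<alpha> * p / (8 * C))" using n0 p0 \<alpha> C by (subst ennreal_plus) auto
  finally have X1: "X + ennreal (\<alpha> * n) \<le> ennreal (n + \<alpha> * p / (8 * C))" .
  then have "X < \<top>" by (cases X) (auto simp: top_unique)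
  then obtain x where x: "X = ennreal x" "0 \<le> x" by (cases X) auto
  have x_le: "x + \<alpha> * n \<le> n + \<alpha> * p / (8 * C)"
    using X1 x n0 p0 \<alpha> C by (simp add: ennreal_plus[symmetric] del: ennreal_plus)
  have Y_le: "Y \<le> ennreal (p / 4 + C * n)"
  proof -
    have "Y \<le> (\<integral>\<^sup>+x. \<integral>\<^sup>+y. ennreal (k x y * \<phi> x * \<bar>f y\<bar>) \<partial>N \<partial>M)"
      unfolding Y_def
    proof (rule nn_integral_mono_AE, use F_fin g_eq AE_space in eventually_elim)
      case (elim x)
      have kx[measurable]: "k x \<in> borel_measurable N"
        using measurable_Pair2[OF k, of x] elim(3) by simp
      have "ennreal \<bar>g x\<bar> = ennreal (norm (\<integral>y. k x y * f y \<partial>N))" using elim by simp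
      also have "\<dots> \<le> (\<integral>\<^sup>+y. ennreal (norm (k x y * f y)) \<partial>N)"
      proof (cases "integrable N (\<lambda>y. k x y * f y)")
        case True then show ?thesis by (rule integral_norm_bound_ennreal)
      qed (simp add: not_integrable_integral_eq)
      also have "\<dots> = F x" unfolding F_def by (intro nn_integral_cong) (simp add: abs_mult k0)
      finally have "ennreal \<bar>g x\<bar> * ennreal (\<phi> x) \<le> F x * ennreal (\<phi> x)" by (rule mult_right_mono) simp
      also have "\<dots> = (\<integral>\<^sup>+y. ennreal (k x y * \<phi> x * \<bar>f y\<bar>) \<partial>N)"
        unfolding F_def by (subst nn_integral_multc[symmetric])
          (auto simp: ennreal_mult k0 \<phi>0 mult_ac intro!: nn_integral_cong)
      finally show ?case by (simp add: ennreal_mult \<phi>0)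
    qed
    also have "\<dots> = (\<integral>\<^sup>+y. \<integral>\<^sup>+x. ennreal (k x y * \<phi> x * \<bar>f y\<bar>) \<partial>M \<partial>N)"
      by (rule P.Fubini'[symmetric]) measurable
    also have "\<dots> = (\<integral>\<^sup>+y. (\<integral>\<^sup>+x. ennreal (k x y * \<phi> x) \<partial>M) * ennreal \<bar>f y\<bar> \<partial>N)"
      by (intro nn_integral_cong)
        (subst nn_integral_multc[symmetric], auto simp: ennreal_mult k0 \<phi>0 intro!: nn_integral_cong)
    also have "\<dots> \<le> (\<integral>\<^sup>+y. ennreal (\<psi> y / 4 + C) * ennreal \<bar>f y\<bar> \<partial>N)"
      using drift by (intro nn_integral_mono_AE) (auto elim!: eventually_mono intro!: mult_right_mono simp del: mult_1)
    also have "\<dots> = (\<integral>\<^sup>+y. ennreal (1/4) * ennreal (\<bar>f y\<bar> * \<psi> y) + ennreal C * ennreal \<bar>f y\<bar> \<partial>N)"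
      using \<psi>0 C by (intro nn_integral_cong)
        (auto simp: ennreal_mult[symmetric] ennreal_plus[symmetric] algebra_simps simp del: ennreal_plus)
    also have "\<dots> = ennreal (1/4) * ennreal p + ennreal C * ennreal n"
      by (subst nn_integral_add) (auto simp: nn_integral_cmult n_nn p_nn)
    also have "\<dots> = ennreal (p / 4 + C * n)" using C p0 n0
      by (auto simp: ennreal_mult[symmetric] ennreal_plus[symmetric] simp del: ennreal_plus)
    finally show ?thesis .
  qed
  have "(\<integral>\<^sup>+x. ennreal (\<bar>g x\<bar> * (1 + \<beta> * \<phi> x)) \<partial>M)
      = (\<integral>\<^sup>+x. ennreal \<bar>g x\<bar> + ennreal \<beta> * ennreal (\<bar>g x\<bar> * \<phi> x) \<partial>M)"
    using \<beta>0 \<phi>0 by (intro nn_integral_cong)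
      (auto simp: ennreal_mult[symmetric] ennreal_plus[symmetric] algebra_simps simp del: ennreal_plus)
  also have "\<dots> = X + ennreal \<beta> * Y"
    by (subst nn_integral_add) (auto simp: nn_integral_cmult X_def Y_def)
  also have "\<dots> \<le> ennreal x + ennreal \<beta> * ennreal (p / 4 + C * n)"
    using Y_le x by (intro add_mono mult_left_mono) auto
  also have "\<dots> = ennreal (x + \<beta> * (p / 4 + C * n))" using x \<beta>0 C p0 n0
    by (auto simp: ennreal_mult[symmetric] ennreal_plus[symmetric] simp del: ennreal_plus)
  also have "\<dots> \<le> ennreal ((1 - \<alpha> / 2) * (n + \<beta> * p))"
  proof (rule ennreal_leI)
    have "x + \<beta> * (p / 4 + C * n) \<le> (n + \<alpha> * p / (8 * C) - \<alpha> * n) + \<beta> * (p / 4 + C * n)"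
      using x_le by simp
    also have "\<dots> = (1 - \<alpha> / 2) * n + \<beta> / 2 * p" using C unfolding \<beta> by (simp add: field_simps)
    also have "\<dots> \<le> (1 - \<alpha> / 2) * n + (1 - \<alpha> / 2) * \<beta> * p"
    proof -
      have "1 / 2 * (\<beta> * p) \<le> (1 - \<alpha> / 2) * (\<beta> * p)" using \<alpha> \<beta>0 p0 by (intro mult_right_mono) auto
      then show ?thesis by simp
    qed
    finally show "x + \<beta> * (p / 4 + C * n) \<le> (1 - \<alpha> / 2) * (n + \<beta> * p)" by (simp add: distrib_left mult.assoc)
  qed
  also have "\<dots> = ennreal (1 - \<alpha> / 2) * (ennreal n + ennreal \<beta> * ennreal p)"
    using \<alpha> \<beta>0 n0 p0 by (auto simp: ennreal_mult[symmetric] ennreal_plus[symmetric] simp del: ennreal_plus)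
  also have "ennreal n + ennreal \<beta> * ennreal p = (\<integral>\<^sup>+y. ennreal \<bar>f y\<bar> + ennreal \<beta> * ennreal (\<bar>f y\<bar> * \<psi> y) \<partial>N)"
    by (subst nn_integral_add) (auto simp: nn_integral_cmult n_nn p_nn)
  also have "\<dots> = (\<integral>\<^sup>+y. ennreal (\<bar>f y\<bar> * (1 + \<beta> * \<psi> y)) \<partial>N)"
    using \<beta>0 \<psi>0 by (intro nn_integral_cong)
      (auto simp: ennreal_mult[symmetric] ennreal_plus[symmetric] algebra_simps simp del: ennreal_plus)
  finally show ?thesis .
qed

section \<open>Entropic transforms and their bounds\<close>

definition mean_cost :: "'b measure \<Rightarrow> ('a \<Rightarrow> 'b \<Rightarrow> real) \<Rightarrow> 'a \<Rightarrow> real" where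
  "mean_cost N W x = (\<integral>y. W x y \<partial>N)"

text \<open>Half a Sinkhorn step, with the potentials taken relative to the two Gibbs measures.\<close>

definition soft_transform :: "'b measure \<Rightarrow> ('a \<Rightarrow> 'b \<Rightarrow> real) \<Rightarrow> ('b \<Rightarrow> real) \<Rightarrow> 'a \<Rightarrow> real" where
  "soft_transform N W b x = ln (\<integral>y. exp (- W x y - b y) \<partial>N)"

text \<open>The equation \<open>a = soft_transform N W b\<close> up to null sets, including finiteness of the integral;
  equivalently \<open>exp (- W x y - a x - b y)\<close> is a Markov density in \<open>y\<close> for almost every \<open>x\<close>.\<close>

definition normalises :: "'a measure \<Rightarrow> 'b measure \<Rightarrow> ('a \<Rightarrow> 'b \<Rightarrow> real) \<Rightarrow> ('b \<Rightarrow> real) \<Rightarrow> ('a \<Rightarrow> real) \<Rightarrow> bool" where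
  "normalises M N W b a \<longleftrightarrow> a \<in> borel_measurable M \<and>
     (AE x in M. (\<integral>\<^sup>+y. ennreal (exp (- W x y - b y)) \<partial>N) = ennreal (exp (a x)))"

text \<open>The two-sided control that the Sinkhorn potentials, other than the initial one on the second space,
  satisfy with one common constant.  The lower
  bound has the integrated cost in it, which is where exponential moments of that cost enter.\<close>

definition admissible :: "'a measure \<Rightarrow> 'b measure \<Rightarrow> ('a \<Rightarrow> 'b \<Rightarrow> real) \<Rightarrow> real \<Rightarrow> ('a \<Rightarrow> real) \<Rightarrow> bool" where
  "admissible M N W c a \<longleftrightarrow> a \<in> borel_measurable M \<and>
     (AE x in M. - mean_cost N W x - c \<le> a x \<and> a x \<le> c)"

text \<open>The hypotheses are invariant under exchanging the two spaces (lemma \<open>swap\<close>), so that each half step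
  is treated once and used in both directions.\<close>

locale cost_pair = M: prob_space M + N: prob_space N
  for M :: "'a measure" and N :: "'b measure" +
  fixes W :: "'a \<Rightarrow> 'b \<Rightarrow> real" and w :: real
  assumes W_measurable[measurable]: "case_prod W \<in> borel_measurable (M \<Otimes>\<^sub>M N)"
    and W_lower: "AE x in M. AE y in N. - w \<le> W x y"
    and W_lower': "AE y in N. AE x in M. - w \<le> W x y"
    and W_integrable: "\<And>x. integrable N (\<lambda>y. W x y)"
    and W_integrable': "\<And>y. integrable M (\<lambda>x. W x y)"
    and exp_cost: "integrable M (\<lambda>x. exp (mean_cost N W x))"
    and exp_cost': "integrable N (\<lambda>y. exp (mean_cost M (\<lambda>y x. W x y) y))"
begin

sublocale P: pair_prob_space M N ..

lemma swap: "cost_pair N M (\<lambda>y x. W x y) w"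
proof
  show "(\<lambda>(y, x). W x y) \<in> borel_measurable (N \<Otimes>\<^sub>M M)"
    using measurable_pair_swap[OF W_measurable] by (simp add: split_beta')
qed (use W_lower W_lower' W_integrable W_integrable' exp_cost exp_cost' in auto)

lemma mean_cost_measurable[measurable]: "mean_cost N W \<in> borel_measurable M"
  unfolding mean_cost_def by measurable

lemma mean_cost_lower: "AE x in M. - w \<le> mean_cost N W x"
  using W_lower
proof eventually_elim
  case (elim x)
  have "(\<integral>y. - w \<partial>N) \<le> (\<integral>y. W x y \<partial>N)"
    using elim W_integrable by (intro integral_mono_AE) auto
  then show ?case by (simp add: mean_cost_def N.prob_space)
qed

lemma mean_cost_integrable: "integrable M (mean_cost N W)"
proof (rule Bochner_Integration.integrable_bound)
  show "integrable M (\<lambda>x. \<bar>w\<bar> + exp (mean_cost N W x))" using exp_cost by simp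
  show "AE x in M. norm (mean_cost N W x) \<le> norm (\<bar>w\<bar> + exp (mean_cost N W x))"
    using mean_cost_lower
  proof eventually_elim
    case (elim x)
    have "mean_cost N W x \<le> exp (mean_cost N W x)"
      using exp_ge_add_one_self[of "mean_cost N W x"] by linarith
    then show ?case using elim exp_ge_zero[of "mean_cost N W x"] unfolding real_norm_def by linarith
  qed
qed simp

lemma admissible_integrable:
  assumes "admissible M N W c a"
  shows "integrable M a"
proof (rule Bochner_Integration.integrable_bound)
  show "integrable M (\<lambda>x. \<bar>mean_cost N W x\<bar> + \<bar>c\<bar>)" using mean_cost_integrable by simp
  show "AE x in M. norm (a x) \<le> norm (\<bar>mean_cost N W x\<bar> + \<bar>c\<bar>)"
    using assms unfolding admissible_def real_norm_def by (elim conjE eventually_mono) linarith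
qed (use assms in \<open>simp add: admissible_def\<close>)

lemma normalises_integral:
  assumes "normalises M N W b a" and [measurable]: "b \<in> borel_measurable N"
  shows "AE x in M. integrable N (\<lambda>y. exp (- W x y - b y)) \<and> (\<integral>y. exp (- W x y - b y) \<partial>N) = exp (a x)"
proof -
  have "AE x in M. (\<integral>\<^sup>+y. ennreal (exp (- W x y - b y)) \<partial>N) = ennreal (exp (a x))"
    using assms by (simp add: normalises_def)
  then show ?thesis using AE_space
  proof eventually_elim
    case (elim x)
    have [measurable]: "W x \<in> borel_measurable N" using W_integrable by auto
    have "integrable N (\<lambda>y. exp (- W x y - b y))"
      using elim by (intro integrableI_nonneg) auto
    then show ?case using elim
      by (auto intro!: integral_eq_nn_integral[THEN trans])
  qed
qed

text \<open>The lower bound is Jensen's inequality, so it needs only an upper bound on the mean of \<open>b\<close>; the upper bound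
  inserts the pointwise lower bound on \<open>b\<close> and on the cost and uses the exponential moment of the integrated cost.\<close>

lemma soft_transform_bounds:
  assumes [measurable]: "b \<in> borel_measurable N" and b_int: "integrable N b"
    and b_mean: "(\<integral>y. b y \<partial>N) \<le> d"
    and b_lower: "AE y in N. - mean_cost M (\<lambda>y x. W x y) y - c \<le> b y"
  shows "normalises M N W b (soft_transform N W b)"
    and "AE x in M. - mean_cost N W x - d \<le> soft_transform N W b x \<and>
      soft_transform N W b x \<le> w + c + ln (\<integral>y. exp (mean_cost M (\<lambda>y x. W x y) y) \<partial>N)"
proof -
  define G where "G = mean_cost M (\<lambda>y x. W x y)"
  define E where "E = (\<integral>y. exp (G y) \<partial>N)"
  have G_int: "integrable N (\<lambda>y. exp (G y))" unfolding G_def by (rule exp_cost')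
  have *: "AE x in M. (\<integral>\<^sup>+y. ennreal (exp (- W x y - b y)) \<partial>N) = ennreal (exp (soft_transform N W b x)) \<and>
     - mean_cost N W x - d \<le> soft_transform N W b x \<and> soft_transform N W b x \<le> w + c + ln E"
    using W_lower
  proof eventually_elim
    case (elim x)
    have [measurable]: "W x \<in> borel_measurable N" using W_integrable by auto
    define I where "I = (\<integral>y. exp (- W x y - b y) \<partial>N)"
    have le: "AE y in N. exp (- W x y - b y) \<le> exp (w + c) * exp (G y)"
      using elim b_lower by eventually_elim (auto simp: exp_add[symmetric] G_def)
    have int: "integrable N (\<lambda>y. exp (- W x y - b y))"
    proof (rule Bochner_Integration.integrable_bound)
      show "integrable N (\<lambda>y. exp (w + c) * exp (G y))" using G_int by simp
    qed (use le in auto)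
    have I_le: "I \<le> exp (w + c) * E"
      unfolding I_def E_def using le int G_int
      by (subst integral_mult_right_zero[symmetric]) (intro integral_mono_AE; simp)
    \<comment> \<open>Jensen's inequality for \<open>exp\<close>, by integrating its tangent line at the mean exponent \<open>m\<close>.\<close>
    define m where "m = - mean_cost N W x - (\<integral>y. b y \<partial>N)"
    have "(\<integral>y. exp m * (1 + ((- W x y - b y) - m)) \<partial>N) \<le> I"
      unfolding I_def
    proof (rule integral_mono)
      fix y
      have "exp m * (1 + ((- W x y - b y) - m)) \<le> exp m * exp ((- W x y - b y) - m)"
        by (intro mult_left_mono exp_ge_add_one_self) simp
      then show "exp m * (1 + ((- W x y - b y) - m)) \<le> exp (- W x y - b y)"
        by (simp add: exp_diff)
    qed (use int b_int W_integrable in auto)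
    also have "(\<integral>y. exp m * (1 + ((- W x y - b y) - m)) \<partial>N) = exp m"
      using W_integrable b_int by (simp add: m_def mean_cost_def N.prob_space)
    finally have I_ge: "exp m \<le> I" .
    then have I0: "0 < I" using exp_gt_zero[of m] by linarith
    have E0: "0 < E" using I0 I_le by (metis exp_gt_zero less_le_trans zero_less_mult_pos)
    have s: "soft_transform N W b x = ln I" by (simp add: soft_transform_def I_def)
    have "m \<le> ln I" using I_ge I0 by (simp add: ln_ge_iff)
    moreover have "ln I \<le> w + c + ln E" 
      using ln_mono[OF I_le I0] E0 by (simp add: ln_mult)
    moreover have "(\<integral>\<^sup>+y. ennreal (exp (- W x y - b y)) \<partial>N) = ennreal I"
      unfolding I_def using int by (intro nn_integral_eq_integral) auto
    ultimately show ?case using b_mean I0 by (auto simp: s m_def)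
  qed
  have "soft_transform N W b \<in> borel_measurable M" unfolding soft_transform_def by measurable
  then show "normalises M N W b (soft_transform N W b)" using * by (auto simp: normalises_def)
  show "AE x in M. - mean_cost N W x - d \<le> soft_transform N W b x \<and>
      soft_transform N W b x \<le> w + c + ln (\<integral>y. exp (mean_cost M (\<lambda>y x. W x y) y) \<partial>N)"
    using * by (auto simp: E_def G_def)
qed

text \<open>For \<open>b\<close>, \<open>a\<close>, \<open>b'\<close> three successive potentials, \<open>exp (b' - b)\<close> is the second marginal density of the coupling
  \<open>exp (- W - a - b)\<close>, whose first marginal is \<open>M\<close>; hence its mass is one.\<close>

lemma marginal_mass:
  assumes "normalises M N W b a" and "normalises N M (\<lambda>y x. W x y) a b'"
    and [measurable]: "b \<in> borel_measurable N"
  shows "(\<integral>\<^sup>+y. ennreal (exp (b' y - b y)) \<partial>N) = 1"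
proof -
  have [measurable]: "a \<in> borel_measurable M" "b' \<in> borel_measurable N"
    using assms by (auto simp: normalises_def)
  have "(\<integral>\<^sup>+y. ennreal (exp (b' y - b y)) \<partial>N)
      = (\<integral>\<^sup>+y. (\<integral>\<^sup>+x. ennreal (exp (- W x y - a x - b y)) \<partial>M) \<partial>N)"
  proof (rule nn_integral_cong_AE)
    have "AE y in N. (\<integral>\<^sup>+x. ennreal (exp (- W x y - a x)) \<partial>M) = ennreal (exp (b' y))"
      using assms by (simp add: normalises_def)
    then show "AE y in N. ennreal (exp (b' y - b y)) = (\<integral>\<^sup>+x. ennreal (exp (- W x y - a x - b y)) \<partial>M)"
    proof eventually_elim
      case (elim y)
      have [measurable]: "(\<lambda>x. W x y) \<in> borel_measurable M" using W_integrable' by auto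
      have "(\<integral>\<^sup>+x. ennreal (exp (- W x y - a x - b y)) \<partial>M)
        = (\<integral>\<^sup>+x. ennreal (exp (- b y)) * ennreal (exp (- W x y - a x)) \<partial>M)"
        by (intro nn_integral_cong) (simp add: ennreal_mult[symmetric] exp_add[symmetric])
      also have "\<dots> = ennreal (exp (- b y)) * ennreal (exp (b' y))"
        by (subst nn_integral_cmult) (auto simp: elim)
      finally show ?case by (simp add: ennreal_mult[symmetric] exp_add[symmetric])
    qed
  qed
  also have "\<dots> = (\<integral>\<^sup>+x. (\<integral>\<^sup>+y. ennreal (exp (- W x y - a x - b y)) \<partial>N) \<partial>M)"
    by (rule P.Fubini') measurable
  also have "\<dots> = (\<integral>\<^sup>+x. 1 \<partial>M)"
  proof (rule nn_integral_cong_AE)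
    have "AE x in M. (\<integral>\<^sup>+y. ennreal (exp (- W x y - b y)) \<partial>N) = ennreal (exp (a x))"
      using assms by (simp add: normalises_def)
    then show "AE x in M. (\<integral>\<^sup>+y. ennreal (exp (- W x y - a x - b y)) \<partial>N) = 1"
    proof eventually_elim
      case (elim x)
      have [measurable]: "W x \<in> borel_measurable N" using W_integrable by auto
      have "(\<integral>\<^sup>+y. ennreal (exp (- W x y - a x - b y)) \<partial>N)
        = (\<integral>\<^sup>+y. ennreal (exp (- a x)) * ennreal (exp (- W x y - b y)) \<partial>N)"
        by (intro nn_integral_cong) (simp add: ennreal_mult[symmetric] exp_add[symmetric])
      also have "\<dots> = ennreal (exp (- a x)) * ennreal (exp (a x))"
        by (subst nn_integral_cmult) (auto simp: elim)
      finally show ?case by (simp add: ennreal_mult[symmetric] exp_add[symmetric])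
    qed
  qed
  also have "\<dots> = 1" by (simp add: M.emeasure_space_1)
  finally show ?thesis .
qed

lemma marginal_density_integrable:
  assumes "normalises M N W b a" and "normalises N M (\<lambda>y x. W x y) a b'"
    and [measurable]: "b \<in> borel_measurable N"
  shows "integrable N (\<lambda>y. exp (b' y - b y))" and "(\<integral>y. exp (b' y - b y) \<partial>N) = 1"
proof -
  have [measurable]: "b' \<in> borel_measurable N" using assms by (auto simp: normalises_def)
  show i: "integrable N (\<lambda>y. exp (b' y - b y))"
    using marginal_mass[OF assms] by (intro integrableI_nonneg) auto
  show "(\<integral>y. exp (b' y - b y) \<partial>N) = 1"
    using marginal_mass[OF assms] by (subst integral_eq_nn_integral) auto
qed

text \<open>The relative entropy of \<open>N\<close> with respect to the marginal \<open>exp (b' - b) N\<close> is the difference of the means,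
  hence nonnegative.  This monotonicity makes the bounds on the potentials uniform along the iteration.\<close>

lemma mean_potential_decreasing:
  assumes "normalises M N W b a" and "normalises N M (\<lambda>y x. W x y) a b'"
    and b: "integrable N b" and b': "integrable N b'"
  shows "(\<integral>y. b' y \<partial>N) \<le> (\<integral>y. b y \<partial>N)"
proof -
  note d = marginal_density_integrable[OF assms(1,2) borel_measurable_integrable[OF b]]
  have "(\<integral>y. b' y - b y \<partial>N) \<le> (\<integral>y. exp (b' y - b y) - 1 \<partial>N)"
  proof (rule integral_mono)
    show "b' y - b y \<le> exp (b' y - b y) - 1" for y using exp_ge_add_one_self[of "b' y - b y"] by linarith
  qed (use b b' d in auto)
  also have "\<dots> = 0" using d by (simp add: N.prob_space)
  finally show ?thesis using b b' by simp
qed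

end

section \<open>Contraction of one half step\<close>

text \<open>The small-cost axioms say that \<open>\<phi>\<close> and \<open>\<psi>\<close> dominate the exponentials of the integrated costs with an arbitrarily
  small factor (drift); the bounded-cost axioms provide a set of positive measure on which the kernels have a uniform
  lower bound from every sublevel set of the other weight (minorisation).\<close>

locale weighted_cost_pair = cost_pair M N W w
  for M :: "'a measure" and N :: "'b measure" and W :: "'a \<Rightarrow> 'b \<Rightarrow> real" and w :: real +
  fixes \<phi> :: "'a \<Rightarrow> real" and \<psi> :: "'b \<Rightarrow> real"
  assumes \<phi>_measurable[measurable]: "\<phi> \<in> borel_measurable M"
    and \<psi>_measurable[measurable]: "\<psi> \<in> borel_measurable N"
    and \<phi>_nonneg: "\<And>x. 0 \<le> \<phi> x" and \<psi>_nonneg: "\<And>y. 0 \<le> \<psi> y"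
    and \<phi>_int: "integrable M (\<lambda>x. \<phi> x * exp (mean_cost N W x))"
    and \<psi>_int: "integrable N (\<lambda>y. \<psi> y * exp (mean_cost M (\<lambda>y x. W x y) y))"
    and cost_small: "\<And>\<epsilon>. 0 < \<epsilon> \<Longrightarrow> \<exists>C. \<forall>x. exp (mean_cost N W x) \<le> \<epsilon> * \<phi> x + C"
    and cost_small': "\<And>\<epsilon>. 0 < \<epsilon> \<Longrightarrow> \<exists>C. \<forall>y. exp (mean_cost M (\<lambda>y x. W x y) y) \<le> \<epsilon> * \<psi> y + C"
    and cost_bounded: "\<exists>K\<in>sets M. 0 < measure M K \<and> (\<forall>r. \<exists>B. \<forall>x\<in>K. \<forall>y. \<psi> y \<le> r \<longrightarrow> W x y \<le> B)"
    and cost_bounded': "\<exists>L\<in>sets N. 0 < measure N L \<and> (\<forall>r. \<exists>B. \<forall>y\<in>L. \<forall>x. \<phi> x \<le> r \<longrightarrow> W x y \<le> B)"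
begin

lemma swap_weighted: "weighted_cost_pair N M (\<lambda>y x. W x y) w \<psi> \<phi>"
  by (intro weighted_cost_pair.intro swap weighted_cost_pair_axioms.intro)
    (use \<phi>_nonneg \<psi>_nonneg \<phi>_int \<psi>_int cost_small cost_small' cost_bounded cost_bounded' in auto)

text \<open>Finiteness of the weighted error: admissibility of the two potentials bounds the marginal density
  by a multiple of the exponential of the integrated cost.\<close>

lemma density_moment:
  assumes b: "admissible N M (\<lambda>y x. W x y) c b" and b': "admissible N M (\<lambda>y x. W x y) c b'"
  shows "integrable N (\<lambda>y. \<bar>exp (b' y - b y) - 1\<bar> * \<psi> y)"
proof (rule Bochner_Integration.integrable_bound)
  have [measurable]: "b \<in> borel_measurable N" "b' \<in> borel_measurable N"
    using b b' by (auto simp: admissible_def)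
  let ?G = "mean_cost M (\<lambda>y x. W x y)"
  show "integrable N (\<lambda>y. (exp (2 * c) + exp w) * (\<psi> y * exp (?G y)))" using \<psi>_int by simp
  show "(\<lambda>y. \<bar>exp (b' y - b y) - 1\<bar> * \<psi> y) \<in> borel_measurable N" by measurable
  have "AE y in N. - ?G y - c \<le> b y \<and> b y \<le> c" "AE y in N. - ?G y - c \<le> b' y \<and> b' y \<le> c"
    using b b' by (auto simp: admissible_def)
  then show "AE y in N. norm (\<bar>exp (b' y - b y) - 1\<bar> * \<psi> y) \<le> norm ((exp (2 * c) + exp w) * (\<psi> y * exp (?G y)))"
    using cost_pair.mean_cost_lower[OF swap]
  proof eventually_elim
    case (elim y)
    have "exp (b' y - b y) \<le> exp (2 * c) * exp (?G y)" using elim by (simp add: exp_add[symmetric])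
    moreover have "1 \<le> exp w * exp (?G y)" using elim by (simp add: exp_add[symmetric])
    moreover have "\<bar>exp (b' y - b y) - 1\<bar> \<le> exp (b' y - b y) + 1"
      using exp_gt_zero[of "b' y - b y"] by (auto simp: abs_if)
    ultimately have "\<bar>exp (b' y - b y) - 1\<bar> \<le> (exp (2 * c) + exp w) * exp (?G y)"
      by (simp add: distrib_right)
    then have "\<bar>exp (b' y - b y) - 1\<bar> * \<psi> y \<le> (exp (2 * c) + exp w) * exp (?G y) * \<psi> y"
      using \<psi>_nonneg by (rule mult_right_mono)
    then show ?case using \<psi>_nonneg[of y] by (simp add: abs_mult mult_ac)
  qed
qed

text \<open>Admissibility turns the left-hand side into a constant times \<open>exp (mean_cost M (\<lambda>y x. W x y) y)\<close>, uniformly in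
  the potentials, and this exponential is an arbitrarily small multiple of \<open>\<psi>\<close> up to a constant.\<close>

lemma half_step_drift:
  "\<exists>C>0. \<forall>a b'. admissible M N W c a \<longrightarrow> admissible N M (\<lambda>y x. W x y) c b' \<longrightarrow>
    (AE y in N. (\<integral>\<^sup>+x. ennreal (exp (- W x y - a x - b' y) * \<phi> x) \<partial>M) \<le> ennreal (\<psi> y / 4 + C))"
proof -
  let ?F = "mean_cost N W" and ?G = "mean_cost M (\<lambda>y x. W x y)"
  define E where "E = (\<integral>x. \<phi> x * exp (?F x) \<partial>M)"
  have E0: "0 \<le> E" unfolding E_def using \<phi>_nonneg by (intro integral_nonneg_AE) auto
  define D where "D = exp (w + 2 * c) * E + 1"
  have "0 \<le> exp (w + 2 * c) * E" using E0 by simp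
  then have D0: "0 < D" by (simp add: D_def)
  obtain C where C: "\<And>y. exp (?G y) \<le> 1 / (4 * D) * \<psi> y + C"
    using cost_small'[of "1 / (4 * D)"] D0 by auto
  have main: "AE y in N. (\<integral>\<^sup>+x. ennreal (exp (- W x y - a x - b' y) * \<phi> x) \<partial>M) \<le> ennreal (\<psi> y / 4 + max 1 (D * C))"
    if a: "admissible M N W c a" and b': "admissible N M (\<lambda>y x. W x y) c b'" for a b'
  proof -
    have [measurable]: "a \<in> borel_measurable M" using a by (auto simp: admissible_def)
    have "AE y in N. - ?G y - c \<le> b' y \<and> b' y \<le> c" using b' by (auto simp: admissible_def)
    then show ?thesis using W_lower'
    proof eventually_elim
      case (elim y)
      have "AE x in M. - ?F x - c \<le> a x \<and> a x \<le> c" using a by (auto simp: admissible_def)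
      then have "AE x in M. exp (- W x y - a x - b' y) * \<phi> x \<le> exp (w + 2 * c + ?G y) * (\<phi> x * exp (?F x))"
        using elim(2)
      proof eventually_elim
        case (elim x)
        have "exp (- W x y - a x - b' y) \<le> exp (w + 2 * c + ?G y) * exp (?F x)"
          using elim \<open>- ?G y - c \<le> b' y \<and> b' y \<le> c\<close> by (simp add: exp_add[symmetric])
        then have "exp (- W x y - a x - b' y) * \<phi> x \<le> exp (w + 2 * c + ?G y) * exp (?F x) * \<phi> x"
          using \<phi>_nonneg by (rule mult_right_mono)
        then show ?case by (simp add: mult_ac)
      qed
      then have "(\<integral>\<^sup>+x. ennreal (exp (- W x y - a x - b' y) * \<phi> x) \<partial>M)
        \<le> (\<integral>\<^sup>+x. ennreal (exp (w + 2 * c + ?G y)  * (\<phi> x * exp (?F x))) \<partial>M)"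
        by (intro nn_integral_mono_AE) (auto elim!: eventually_mono intro: ennreal_leI)
      also have "\<dots> = ennreal (exp (w + 2 * c + ?G y) * E)"
        unfolding E_def using \<phi>_int \<phi>_nonneg by (subst nn_integral_eq_integral) auto
      also have "\<dots> \<le> ennreal (\<psi> y / 4 + max 1 (D * C))"
      proof (rule ennreal_leI)
        have "exp (w + 2 * c + ?G y) * E = (exp (w + 2 * c) * E) * exp (?G y)" by (simp add: exp_add)
        also have "\<dots> \<le> D * exp (?G y)" unfolding D_def by (intro mult_right_mono) auto
        also have "\<dots> \<le> D * (1 / (4 * D) * \<psi> y + C)" using C D0 by (intro mult_left_mono) auto
        also have "\<dots> = \<psi> y / 4 + D * C" using D0 by (simp add: field_simps)
        finally show "exp (w + 2 * c + ?G y) * E \<le> \<psi> y / 4 + max 1 (D * C)" by simp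
      qed
      finally show ?case .
    qed
  qed
  show ?thesis by (rule exI[of _ "max 1 (D * C)"]) (use main in auto)
qed

text \<open>The half step sends the error \<open>exp (b' - b) - 1\<close> on the second space to minus the error
  \<open>exp (a' - a) - 1\<close> on the first one, by the kernel \<open>exp (- W - a - b')\<close>.  The constants are
  those of the lemma on weighted contraction.\<close>

definition contracts :: "real \<Rightarrow> real \<Rightarrow> real \<Rightarrow> bool" where
  "contracts c \<alpha> C \<longleftrightarrow> (\<forall>a b a' b'. normalises M N W b a \<longrightarrow> normalises N M (\<lambda>y x. W x y) a b' \<longrightarrow>
     normalises M N W b' a' \<longrightarrow> admissible M N W c a \<longrightarrow> admissible N M (\<lambda>y x. W x y) c b \<longrightarrow>
     admissible N M (\<lambda>y x. W x y) c b' \<longrightarrow>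
     (\<integral>\<^sup>+x. ennreal (\<bar>exp (a' x - a x) - 1\<bar> * (1 + \<alpha> / (2 * C) * \<phi> x)) \<partial>M)
     \<le> ennreal (1 - \<alpha> / 2) * (\<integral>\<^sup>+y. ennreal (\<bar>exp (b' y - b y) - 1\<bar> * (1 + \<alpha> / (2 * C) * \<psi> y)) \<partial>N))"

text \<open>The minorisation constant depends on the sublevel set \<open>\<psi> \<le> 16 C\<close>, so \<open>C\<close> is chosen before \<open>\<alpha>\<close>.
  Every larger \<open>C\<close> and smaller \<open>\<alpha>\<close> is allowed, in order that the half steps in the two directions
  can share one weight and one rate.\<close>

lemma half_step_contracts:
  "\<exists>C1>0. \<forall>C\<ge>C1. \<exists>\<alpha>1>0. \<forall>\<alpha>. 0 < \<alpha> \<and> \<alpha> \<le> \<alpha>1 \<longrightarrow> contracts c \<alpha> C"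
proof -
  obtain C1 where C1: "C1 > 0" and drift: "\<And>a b'. admissible M N W c a \<Longrightarrow> admissible N M (\<lambda>y x. W x y) c b' \<Longrightarrow>
    (AE y in N. (\<integral>\<^sup>+x. ennreal (exp (- W x y - a x - b' y) * \<phi> x) \<partial>M) \<le> ennreal (\<psi> y / 4 + C1))"
    using half_step_drift by blast
  obtain K where K: "K \<in> sets M" "0 < measure M K"
    and KB: "\<And>r. \<exists>B. \<forall>x\<in>K. \<forall>y. \<psi> y \<le> r \<longrightarrow> W x y \<le> B" using cost_bounded by blast
  show ?thesis
  proof (rule exI[of _ C1], intro conjI allI impI C1)
    fix C assume C: "C1 \<le> C"
    obtain B where B: "\<And>x y. x \<in> K \<Longrightarrow> \<psi> y \<le> 16 * C \<Longrightarrow> W x y \<le> B" using KB by blast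
    define \<kappa>1 where "\<kappa>1 = exp (- B - 2 * c)"
    show "\<exists>\<alpha>1>0. \<forall>\<alpha>. 0 < \<alpha> \<and> \<alpha> \<le> \<alpha>1 \<longrightarrow> contracts c \<alpha> C"
    proof (rule exI[of _ "min 1 (\<kappa>1 * measure M K)"], intro conjI allI impI)
      show "0 < min 1 (\<kappa>1 * measure M K)" using K by (simp add: \<kappa>1_def)
      fix \<alpha> assume \<alpha>: "0 < \<alpha> \<and> \<alpha> \<le> min 1 (\<kappa>1 * measure M K)"
      define \<kappa> where "\<kappa> = \<alpha> / measure M K"
      have \<kappa>: "0 \<le> \<kappa>" "\<kappa> \<le> \<kappa>1" "\<alpha> = \<kappa> * measure M K" using \<alpha> K by (auto simp: \<kappa>_def field_simps)
      show "contracts c \<alpha> C" unfolding contracts_def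
      proof (intro allI impI)
        fix a b a' b'
        assume a: "normalises M N W b a" and b': "normalises N M (\<lambda>y x. W x y) a b'" and a': "normalises M N W b' a'"
          and adm: "admissible M N W c a" "admissible N M (\<lambda>y x. W x y) c b" "admissible N M (\<lambda>y x. W x y) c b'"
        have [measurable]: "a \<in> borel_measurable M" "a' \<in> borel_measurable M"
          and b_meas[measurable]: "b \<in> borel_measurable N" "b' \<in> borel_measurable N"
          using a b' a' adm by (auto simp: normalises_def admissible_def)
        note dens = marginal_density_integrable[OF a b' b_meas(1)]
        show "(\<integral>\<^sup>+x. ennreal (\<bar>exp (a' x - a x) - 1\<bar> * (1 + \<alpha> / (2 * C) * \<phi> x)) \<partial>M)
          \<le> ennreal (1 - \<alpha> / 2) * (\<integral>\<^sup>+y. ennreal (\<bar>exp (b' y - b y) - 1\<bar> * (1 + \<alpha> / (2 * C) * \<psi> y)) \<partial>N)"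
        proof (rule weighted_contraction[where k = "\<lambda>x y. exp (- W x y - a x - b' y)" and K = K and \<kappa> = \<kappa> and C = C])
          show "integrable N (\<lambda>y. \<bar>exp (b' y - b y) - 1\<bar> * \<psi> y)"
            using adm by (intro density_moment)
          show "AE x in M. \<bar>exp (a' x - a x) - 1\<bar>
              = \<bar>\<integral>y. exp (- W x y - a x - b' y) * (exp (b' y - b y) - 1) \<partial>N\<bar>"
            using normalises_integral[OF a b_meas(1)] normalises_integral[OF a' b_meas(2)]
          proof eventually_elim
            case (elim x)
            have "(\<integral>y. exp (- W x y - a x - b' y) * (exp (b' y - b y) - 1) \<partial>N)
              = (\<integral>y. exp (- a x) * exp (- W x y - b y) - exp (- a x) * exp (- W x y - b' y) \<partial>N)"
              by (intro Bochner_Integration.integral_cong)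
                (auto simp: right_diff_distrib exp_add[symmetric] algebra_simps)
            also have "\<dots> = exp (- a x) * exp (a x) - exp (- a x) * exp (a' x)"
              using elim by simp
            also have "\<dots> = 1 - exp (a' x - a x)" by (simp add: exp_add[symmetric])
            finally show ?case by simp
          qed
          have "AE y in N. (\<integral>\<^sup>+x. ennreal (exp (- W x y - a x)) \<partial>M) = ennreal (exp (b' y))"
            using b' by (simp add: normalises_def)
          then show "AE y in N. (\<integral>\<^sup>+x. ennreal (exp (- W x y - a x - b' y)) \<partial>M) \<le> 1"
          proof eventually_elim
            case (elim y)
            have [measurable]: "(\<lambda>x. W x y) \<in> borel_measurable M" using W_integrable' by auto
            have "(\<integral>\<^sup>+x. ennreal (exp (- W x y - a x - b' y)) \<partial>M)
              = (\<integral>\<^sup>+x. ennreal (exp (- b' y)) * ennreal (exp (- W x y - a x)) \<partial>M)"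
              by (intro nn_integral_cong) (simp add: ennreal_mult[symmetric] exp_add[symmetric])
            also have "\<dots> = ennreal (exp (- b' y)) * ennreal (exp (b' y))"
              by (subst nn_integral_cmult) (auto simp: elim)
            finally show ?case by (simp add: ennreal_mult[symmetric] exp_add[symmetric])
          qed
          show "AE y in N. (\<integral>\<^sup>+x. ennreal (exp (- W x y - a x - b' y) * \<phi> x) \<partial>M) \<le> ennreal (\<psi> y / 4 + C)"
            using drift[OF adm(1,3)]
            by eventually_elim (use C in \<open>auto elim!: order_trans intro!: ennreal_leI\<close>)
          have ax: "AE x in M. a x \<le> c" and by': "AE y in N. b' y \<le> c"
            using adm by (auto simp: admissible_def)
          show "AE x in M. x \<in> K \<longrightarrow> (AE y in N. \<psi> y \<le> 16 * C \<longrightarrow> \<kappa> \<le> exp (- W x y - a x - b' y))"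
            using ax
          proof (eventually_elim, intro impI)
            fix x assume x: "a x \<le> c" "x \<in> K"
            show "AE y in N. \<psi> y \<le> 16 * C \<longrightarrow> \<kappa> \<le> exp (- W x y - a x - b' y)"
              using by'
            proof (eventually_elim, intro impI)
              fix y assume y: "b' y \<le> c" "\<psi> y \<le> 16 * C"
              have "\<kappa>1 \<le> exp (- W x y - a x - b' y)"
                unfolding \<kappa>1_def using B[OF x(2) y(2)] x y by simp
              then show "\<kappa> \<le> exp (- W x y - a x - b' y)" using \<kappa> by simp
            qed
          qed
          show "(\<integral>y. exp (b' y - b y) - 1 \<partial>N) = 0" using dens by (simp add: N.prob_space)
        qed (use dens \<kappa> \<alpha> K C C1 \<phi>_nonneg \<psi>_nonneg in \<open>auto intro: M.finite_measure_axioms N.sigma_finite_measure_axioms\<close>)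
      qed
    qed
  qed
qed

end

section \<open>The iteration\<close>

context cost_pair
begin

text \<open>Means are bounded first: the mean of \<open>a n\<close> starts at 0 and that of \<open>b 1\<close> is bounded by its pointwise upper bound,
  and neither mean increases along the iteration.  With these, the bounds of \<open>soft_transform_bounds\<close> reproduce
  themselves: the lower bound of each potential comes from the mean of its predecessor, the upper bound from the
  lower bound of its predecessor, so the constants do not grow.\<close>

lemma sinkhorn_potentials_bounded:
  fixes a :: "nat \<Rightarrow> 'a \<Rightarrow> real" and b :: "nat \<Rightarrow> 'b \<Rightarrow> real"
  assumes a0: "a 0 = (\<lambda>_. 0)"
    and b_Suc: "\<And>n. b (Suc n) = soft_transform M (\<lambda>y x. W x y) (a n)"
    and a_Suc: "\<And>n. a (Suc n) = soft_transform N W (b (Suc n))"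
  shows "\<exists>c. \<forall>n. admissible M N W c (a n) \<and> admissible N M (\<lambda>y x. W x y) c (b (Suc n)) \<and>
    normalises N M (\<lambda>y x. W x y) (a n) (b (Suc n)) \<and> normalises M N W (b (Suc n)) (a (Suc n))"
proof -
  interpret S: cost_pair N M "\<lambda>y x. W x y" w by (rule swap)
  let ?F = "mean_cost N W" and ?G = "mean_cost M (\<lambda>y x. W x y)"
  define p where "p = ln (\<integral>x. exp (?F x) \<partial>M)"
  define q where "q = ln (\<integral>y. exp (?G y) \<partial>N)"
  define d where "d = w + w + p"
  define k where "k = \<bar>w\<bar> + \<bar>d\<bar>"
  define c where "c = Max {k, w + q, w + k + p}"
  have k: "w \<le> k" "d \<le> k" "0 \<le> k" unfolding k_def by linarith+
  have c: "k \<le> c" "w + q \<le> c" "w + k + p \<le> c"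
    unfolding c_def by (rule Max_ge, simp, blast)+
  \<comment> \<open>A lower bound on \<open>a n\<close> and the sign of its mean bound \<open>b (n + 1)\<close> on both sides.\<close>
  have half: "normalises N M (\<lambda>y x. W x y) (a n) (b (Suc n)) \<and> admissible N M (\<lambda>y x. W x y) c (b (Suc n)) \<and>
      (AE y in N. - ?G y - 0 \<le> b (Suc n) y)"
    if int: "integrable M (a n)" and mean: "(\<integral>x. a n x \<partial>M) \<le> 0"
      and low: "AE x in M. - ?F x - k \<le> a n x" for n
  proof -
    have m: "a n \<in> borel_measurable M" using int by auto
    note st = S.soft_transform_bounds[OF m int mean low]
    have up: "AE y in N. - ?G y - 0 \<le> b (Suc n) y \<and> b (Suc n) y \<le> w + k + p"
      using st(2) unfolding b_Suc p_def .
    then have "AE y in N. - ?G y - c \<le> b (Suc n) y \<and> b (Suc n) y \<le> c"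
      by eventually_elim (use c k in linarith)
    moreover have "AE y in N. - ?G y - 0 \<le> b (Suc n) y" using up by eventually_elim simp
    ultimately show ?thesis using st(1) unfolding b_Suc by (simp add: admissible_def normalises_def)
  qed
  have "integrable M (a n) \<and> (\<integral>x. a n x \<partial>M) \<le> 0 \<and> (AE x in M. - ?F x - k \<le> a n x) \<and>
      admissible M N W c (a n) \<and> (\<integral>y. b (Suc n) y \<partial>N) \<le> d" for n
  proof (induction n)
    case 0
    have F0: "AE x in M. - ?F x - w \<le> (\<lambda>_. 0) x" using mean_cost_lower by eventually_elim linarith
    then have "AE x in M. - ?F x - k \<le> a 0 x \<and> - ?F x - c \<le> a 0 x \<and> a 0 x \<le> c"
      by eventually_elim (use c k in \<open>simp add: a0\<close>)
    then have F1: "AE x in M. - ?F x - k \<le> a 0 x" "admissible M N W c (a 0)"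
      by (auto simp: a0 admissible_def)
    have int0: "integrable M (a 0)" and mean0: "(\<integral>x. a 0 x \<partial>M) \<le> 0" by (simp_all add: a0)
    have "admissible N M (\<lambda>y x. W x y) c (b 1)" using half[OF int0 mean0 F1(1)] by simp
    then have b_int: "integrable N (b 1)" by (rule S.admissible_integrable)
    have m0: "(\<lambda>_. 0 :: real) \<in> borel_measurable M" and i0: "integrable M (\<lambda>_. 0 :: real)"
      and z0: "(\<integral>x. 0 \<partial>M) \<le> (0 :: real)" by simp_all
    have "AE y in N. b 1 y \<le> d"
      using S.soft_transform_bounds(2)[OF m0 i0 z0 F0] unfolding One_nat_def b_Suc a0 d_def p_def
      by eventually_elim simp
    then have "(\<integral>y. b 1 y \<partial>N) \<le> (\<integral>y. d \<partial>N)" using b_int by (intro integral_mono_AE) auto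
    then show ?case using F1 int0 mean0 by (simp add: N.prob_space)
  next
    case (Suc n)
    have IH: "integrable M (a n)" "(\<integral>x. a n x \<partial>M) \<le> 0" "AE x in M. - ?F x - k \<le> a n x"
      and mean: "(\<integral>y. b (Suc n) y \<partial>N) \<le> d" using Suc by simp_all
    note h = half[OF IH]
    have b_int: "integrable N (b (Suc n))" using h S.admissible_integrable by blast
    have m: "b (Suc n) \<in> borel_measurable N" using b_int by auto
    have low: "AE y in N. - ?G y - 0 \<le> b (Suc n) y" using h by blast
    note st = soft_transform_bounds[OF m b_int mean low]
    have norm: "normalises M N W (b (Suc n)) (a (Suc n))" using st(1) unfolding a_Suc .
    have bd: "AE x in M. - ?F x - d \<le> a (Suc n) x \<and> a (Suc n) x \<le> w + 0 + q"
      using st(2) unfolding a_Suc q_def .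
    then have "AE x in M. - ?F x - c \<le> a (Suc n) x \<and> a (Suc n) x \<le> c"
      by eventually_elim (use c k in linarith)
    then have adm: "admissible M N W c (a (Suc n))" using norm by (auto simp: admissible_def normalises_def)
    have low': "AE x in M. - ?F x - k \<le> a (Suc n) x" using bd by eventually_elim (use k in linarith)
    have a_int: "integrable M (a (Suc n))" using adm by (rule admissible_integrable)
    have a_mean: "(\<integral>x. a (Suc n) x \<partial>M) \<le> 0"
      using S.mean_potential_decreasing[OF _ norm IH(1) a_int] h IH(2) by linarith
    note h' = half[OF a_int a_mean low']
    have "(\<integral>y. b (Suc (Suc n)) y \<partial>N) \<le> d"
      using mean_potential_decreasing[OF norm _ b_int, of "b (Suc (Suc n))"] h' mean
        S.admissible_integrable[of c "b (Suc (Suc n))"] by linarith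
    then show ?case using a_int a_mean low' adm by simp
  qed
  then have inv: "integrable M (a n)" "(\<integral>x. a n x \<partial>M) \<le> 0" "AE x in M. - ?F x - k \<le> a n x"
      "admissible M N W c (a n)" "(\<integral>y. b (Suc n) y \<partial>N) \<le> d" for n by blast+
  note h = half[OF inv(1-3)]
  show ?thesis
  proof (rule exI[of _ c], intro allI conjI)
    fix n
    show "admissible M N W c (a n)" by (rule inv)
    show b1: "admissible N M (\<lambda>y x. W x y) c (b (Suc n))" using h by blast
    show "normalises N M (\<lambda>y x. W x y) (a n) (b (Suc n))" using h by blast
    have m: "b (Suc n) \<in> borel_measurable N" using b1 by (auto simp: admissible_def)
    have i: "integrable N (b (Suc n))" using b1 by (rule S.admissible_integrable)
    have l: "AE y in N. - ?G y - 0 \<le> b (Suc n) y" using h by blast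
    show "normalises M N W (b (Suc n)) (a (Suc n))"
      unfolding a_Suc by (rule soft_transform_bounds(1)[OF m i inv(5) l])
  qed
qed

end

lemma geometric_decay:
  fixes t :: "nat \<Rightarrow> ennreal"
  assumes "\<And>n. t (Suc n) \<le> ennreal \<rho> * t n" and "0 \<le> \<rho>"
  shows "t (m + n) \<le> ennreal (\<rho> ^ n) * t m"
proof (induction n)
  case (Suc n)
  have "t (m + Suc n) \<le> ennreal \<rho> * t (m + n)" using assms(1)[of "m + n"] by simp
  also have "\<dots> \<le> ennreal \<rho> * (ennreal (\<rho> ^ n) * t m)" using Suc by (rule mult_left_mono) simp
  also have "\<dots> = ennreal (\<rho> ^ Suc n) * t m" using assms(2) by (simp add: ennreal_mult mult.assoc)
  finally show ?case .
qed simp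

context weighted_cost_pair
begin

text \<open>The errors on the second space start with \<open>b 2\<close> and \<open>b 1\<close>: a finite weighted moment of
  \<open>exp (b 1 - b 0)\<close> would need a lower bound on \<open>b 0\<close>, which is no transform of another potential.\<close>

lemma sinkhorn_contraction:
  fixes a :: "nat \<Rightarrow> 'a \<Rightarrow> real" and b :: "nat \<Rightarrow> 'b \<Rightarrow> real"
  assumes "a 0 = (\<lambda>_. 0)"
    and "\<And>n. b (Suc n) = soft_transform M (\<lambda>y x. W x y) (a n)"
    and "\<And>n. a (Suc n) = soft_transform N W (b (Suc n))"
  shows "\<exists>\<beta> \<rho>. 0 < \<beta> \<and> 0 \<le> \<rho> \<and> \<rho> < 1 \<and> (\<forall>n.
    normalises N M (\<lambda>y x. W x y) (a n) (b (Suc n)) \<and> normalises M N W (b (Suc n)) (a (Suc n)) \<and>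
    integrable M (\<lambda>x. \<bar>exp (a (Suc n) x - a n x) - 1\<bar> * \<phi> x) \<and>
    integrable N (\<lambda>y. \<bar>exp (b (Suc (Suc n)) y - b (Suc n) y) - 1\<bar> * \<psi> y) \<and>
    (\<integral>\<^sup>+x. ennreal (\<bar>exp (a (Suc (Suc n)) x - a (Suc n) x) - 1\<bar> * (1 + \<beta> * \<phi> x)) \<partial>M)
      \<le> ennreal \<rho> * (\<integral>\<^sup>+x. ennreal (\<bar>exp (a (Suc n) x - a n x) - 1\<bar> * (1 + \<beta> * \<phi> x)) \<partial>M) \<and>
    (\<integral>\<^sup>+y. ennreal (\<bar>exp (b (Suc (Suc (Suc n))) y - b (Suc (Suc n)) y) - 1\<bar> * (1 + \<beta> * \<psi> y)) \<partial>N)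
      \<le> ennreal \<rho> * (\<integral>\<^sup>+y. ennreal (\<bar>exp (b (Suc (Suc n)) y - b (Suc n) y) - 1\<bar> * (1 + \<beta> * \<psi> y)) \<partial>N))"
proof -
  interpret S: weighted_cost_pair N M "\<lambda>y x. W x y" w \<psi> \<phi> by (rule swap_weighted)
  obtain c where c: "\<And>n. admissible M N W c (a n)" "\<And>n. admissible N M (\<lambda>y x. W x y) c (b (Suc n))"
      "\<And>n. normalises N M (\<lambda>y x. W x y) (a n) (b (Suc n))" "\<And>n. normalises M N W (b (Suc n)) (a (Suc n))"
    using sinkhorn_potentials_bounded[of a b, OF assms] by blast
  obtain C1 where C1: "0 < C1" "\<And>C. C1 \<le> C \<Longrightarrow> \<exists>\<alpha>1>0. \<forall>\<alpha>. 0 < \<alpha> \<and> \<alpha> \<le> \<alpha>1 \<longrightarrow> contracts c \<alpha> C"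
    using half_step_contracts[of c] by blast
  obtain C2 where C2: "0 < C2" "\<And>C. C2 \<le> C \<Longrightarrow> \<exists>\<alpha>1>0. \<forall>\<alpha>. 0 < \<alpha> \<and> \<alpha> \<le> \<alpha>1 \<longrightarrow> S.contracts c \<alpha> C"
    using S.half_step_contracts[of c] by blast
  define C where "C = max C1 C2"
  obtain \<alpha>1 where \<alpha>1: "0 < \<alpha>1" "\<And>\<alpha>. 0 < \<alpha> \<Longrightarrow> \<alpha> \<le> \<alpha>1 \<Longrightarrow> contracts c \<alpha> C"
    using C1(2)[of C] by (auto simp: C_def)
  obtain \<alpha>2 where \<alpha>2: "0 < \<alpha>2" "\<And>\<alpha>. 0 < \<alpha> \<Longrightarrow> \<alpha> \<le> \<alpha>2 \<Longrightarrow> S.contracts c \<alpha> C"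
    using C2(2)[of C] by (auto simp: C_def)
  define \<alpha> where "\<alpha> = min 1 (min \<alpha>1 \<alpha>2)"
  have \<alpha>: "0 < \<alpha>" "\<alpha> \<le> 1" "contracts c \<alpha> C" "S.contracts c \<alpha> C"
    using \<alpha>1(1) \<alpha>2(1) by (auto simp: \<alpha>_def intro!: \<alpha>1(2) \<alpha>2(2))
  define \<beta> where "\<beta> = \<alpha> / (2 * C)"
  define \<rho> where "\<rho> = 1 - \<alpha> / 2"
  have C0: "0 < C" using C1 by (simp add: C_def)
  have \<rho>: "0 \<le> \<rho>" "\<rho> \<le> 1" "\<rho> < 1" using \<alpha> by (auto simp: \<rho>_def)
  define f where "f n = (\<integral>\<^sup>+x. ennreal (\<bar>exp (a (Suc n) x - a n x) - 1\<bar> * (1 + \<beta> * \<phi> x)) \<partial>M)" for n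
  define g where "g n = (\<integral>\<^sup>+y. ennreal (\<bar>exp (b (Suc (Suc n)) y - b (Suc n) y) - 1\<bar> * (1 + \<beta> * \<psi> y)) \<partial>N)" for n
  have gf: "g n \<le> ennreal \<rho> * f n" for n
    using \<alpha>(4) c unfolding S.contracts_def f_def g_def \<beta>_def \<rho>_def by blast
  have fg: "f (Suc n) \<le> ennreal \<rho> * g n" for n
    using \<alpha>(3) c unfolding contracts_def f_def g_def \<beta>_def \<rho>_def by blast
  have le: "ennreal \<rho> * t \<le> t" for t
    using mult_right_mono[of "ennreal \<rho>" 1 t] \<rho> by simp
  have "f (Suc n) \<le> ennreal \<rho> * f n" for n
    by (meson fg gf le mult_left_mono order_trans zero_le)
  moreover have "g (Suc n) \<le> ennreal \<rho> * g n" for n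
    by (meson fg gf le mult_left_mono order_trans zero_le)
  moreover have "0 < \<beta>" using \<alpha> C0 by (simp add: \<beta>_def)
  ultimately show ?thesis
    using \<rho> c S.density_moment[OF c(1) c(1)] density_moment[OF c(2) c(2)] unfolding f_def g_def
    by (intro exI[of _ \<beta>] exI[of _ \<rho>] conjI allI; assumption?) blast+
qed

end

section \<open>Total variation of measures with densities\<close>

text \<open>The supremum over partitions is attained at the Hahn decomposition of \<open>A\<close> into \<open>1 \<le> h\<close> and \<open>h < 1\<close>.\<close>

lemma variation_diff_density:
  assumes "finite_measure N" and h: "integrable N h" and h0: "\<And>x. 0 \<le> h x"
  shows "variation_diff (density N (\<lambda>x. ennreal (h x))) N = density N (\<lambda>x. ennreal \<bar>h x - 1\<bar>)"
proof -
  interpret finite_measure N by fact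
  have [measurable]: "h \<in> borel_measurable N" using h by auto
  let ?D = "density N (\<lambda>x. ennreal \<bar>h x - 1\<bar>)"
  define s where "s B = measure (density N (\<lambda>x. ennreal (h x))) B - measure N B" for B
  have int: "integrable N (\<lambda>x. (h x - 1) * indicator B x)" if "B \<in> sets N" for B
    using integrable_mult_indicator[OF that, of "\<lambda>x. h x - 1"] h by (simp add: mult.commute)
  have s: "s B = (\<integral>x. (h x - 1) * indicator B x \<partial>N)" if B[measurable]: "B \<in> sets N" for B
  proof -
    have i: "integrable N (\<lambda>x. h x * indicator B x)"
      using h by (rule Bochner_Integration.integrable_bound) (auto simp: indicator_def)
    have "emeasure (density N (\<lambda>x. ennreal (h x))) B = (\<integral>\<^sup>+x. ennreal (h x * indicator B x) \<partial>N)"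
      by (subst emeasure_density) (auto intro!: nn_integral_cong simp: indicator_def)
    also have "\<dots> = ennreal (\<integral>x. h x * indicator B x \<partial>N)"
      using i h0 by (intro nn_integral_eq_integral) auto
    finally have "measure (density N (\<lambda>x. ennreal (h x))) B = (\<integral>x. h x * indicator B x \<partial>N)"
      using h0 by (simp add: measure_def integral_nonneg_AE)
    moreover have "(\<integral>x. (h x - 1) * indicator B x \<partial>N) = (\<integral>x. h x * indicator B x \<partial>N) - (\<integral>x. indicator B x \<partial>N)"
      using i by (subst Bochner_Integration.integral_diff[symmetric])
        (auto simp: left_diff_distrib less_top[symmetric])
    ultimately show ?thesis by (simp add: s_def)
  qed
  have D: "emeasure ?D B = (\<integral>\<^sup>+x. ennreal (\<bar>h x - 1\<bar> * indicator B x) \<partial>N)" if [measurable]: "B \<in> sets N" for B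
    by (subst emeasure_density) (auto intro!: nn_integral_cong simp: indicator_def)
  have upper: "ennreal \<bar>s B\<bar> \<le> emeasure ?D B" if B[measurable]: "B \<in> sets N" for B
  proof -
    have "ennreal \<bar>s B\<bar> \<le> (\<integral>\<^sup>+x. ennreal (norm ((h x - 1) * indicator B x)) \<partial>N)"
      unfolding s[OF B] real_norm_def[symmetric] by (rule integral_norm_bound_ennreal) (rule int[OF B])
    then show ?thesis by (simp add: D abs_mult)
  qed
  have exact: "ennreal \<bar>s B\<bar> = emeasure ?D B"
    if B[measurable]: "B \<in> sets N" and sgn: "(\<forall>x\<in>B. 1 \<le> h x) \<or> (\<forall>x\<in>B. h x \<le> 1)" for B
  proof -
    have "emeasure ?D B = ennreal (\<integral>x. \<bar>h x - 1\<bar> * indicator B x \<partial>N)"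
      unfolding D[OF B] using int[OF B, THEN integrable_abs]
      by (intro nn_integral_eq_integral) (auto simp: abs_mult)
    also have "(\<integral>x. \<bar>h x - 1\<bar> * indicator B x \<partial>N) = \<bar>s B\<bar>"
      using sgn
    proof
      assume "\<forall>x\<in>B. 1 \<le> h x"
      then have "(\<integral>x. \<bar>h x - 1\<bar> * indicator B x \<partial>N) = s B" and "0 \<le> s B"
        unfolding s[OF B] by (auto intro!: Bochner_Integration.integral_cong integral_nonneg_AE simp: indicator_def)
      then show ?thesis by simp
    next
      assume *: "\<forall>x\<in>B. h x \<le> 1"
      then have "(\<integral>x. \<bar>h x - 1\<bar> * indicator B x \<partial>N) = (\<integral>x. - ((h x - 1) * indicator B x) \<partial>N)"
        by (intro Bochner_Integration.integral_cong) (auto simp: indicator_def)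
      also have "\<dots> = - s B" by (simp add: s[OF B])
      finally have "(\<integral>x. \<bar>h x - 1\<bar> * indicator B x \<partial>N) = - s B" .
      moreover have "0 \<le> (\<integral>x. \<bar>h x - 1\<bar> * indicator B x \<partial>N)" by (intro integral_nonneg_AE) auto
      ultimately show ?thesis by simp
    qed
    finally show ?thesis by simp
  qed
  have "(SUP P \<in> {P. finite P \<and> partition_on A P \<and> P \<subseteq> sets N}. \<Sum>B\<in>P. ennreal \<bar>s B\<bar>) = emeasure ?D A"
    if A[measurable]: "A \<in> sets N" for A
  proof (rule antisym)
    show "(SUP P \<in> {P. finite P \<and> partition_on A P \<and> P \<subseteq> sets N}. \<Sum>B\<in>P. ennreal \<bar>s B\<bar>) \<le> emeasure ?D A"
    proof (rule SUP_least, clarify)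
      fix P assume P: "finite P" "partition_on A P" "P \<subseteq> sets N"
      have "(\<Sum>B\<in>P. ennreal \<bar>s B\<bar>) \<le> (\<Sum>B\<in>P. emeasure ?D B)" using P by (intro sum_mono upper) auto
      also have "\<dots> = emeasure ?D (\<Union>B\<in>P. B)"
        using P by (intro sum_emeasure) (auto simp: partition_on_def disjoint_def disjoint_family_on_def)
      also have "(\<Union>B\<in>P. B) = A" using P by (auto simp: partition_on_def)
      finally show "(\<Sum>B\<in>P. ennreal \<bar>s B\<bar>) \<le> emeasure ?D A" .
    qed
    define A1 where "A1 = A \<inter> {x \<in> space N. 1 \<le> h x}"
    define A2 where "A2 = A \<inter> {x \<in> space N. h x < 1}"
    have A12[measurable]: "A1 \<in> sets N" "A2 \<in> sets N" by (auto simp: A1_def A2_def)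
    have dis: "A1 \<inter> A2 = {}" "A = A1 \<union> A2" using sets.sets_into_space[OF A] by (auto simp: A1_def A2_def)
    define P where "P = {A1, A2} - {{}}"
    have P: "finite P" "partition_on A P" "P \<subseteq> sets N"
      using dis by (auto simp: P_def partition_on_def disjoint_def)
    have "emeasure ?D A = emeasure ?D A1 + emeasure ?D A2"
      using dis by (simp add: plus_emeasure)
    also have "\<dots> = ennreal \<bar>s A1\<bar> + ennreal \<bar>s A2\<bar>"
      by (subst (1 2) exact) (auto simp: A1_def A2_def)
    also have "\<dots> = (\<Sum>B\<in>P. ennreal \<bar>s B\<bar>)"
    proof -
      have e: "s {} = 0" by (simp add: s_def)
      have "(\<Sum>B\<in>P. ennreal \<bar>s B\<bar>) = (\<Sum>B\<in>{A1, A2}. ennreal \<bar>s B\<bar>)"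
        by (rule sum.mono_neutral_left) (auto simp: P_def e)
      then show ?thesis using dis e by (cases "A1 = A2") auto
    qed
    also have "\<dots> \<le> (SUP P \<in> {P. finite P \<and> partition_on A P \<and> P \<subseteq> sets N}. \<Sum>B\<in>P. ennreal \<bar>s B\<bar>)"
      using P by (intro SUP_upper) auto
    finally show "emeasure ?D A \<le> (SUP P \<in> {P. finite P \<and> partition_on A P \<and> P \<subseteq> sets N}. \<Sum>B\<in>P. ennreal \<bar>s B\<bar>)" .
  qed
  then have "variation_diff (density N (\<lambda>x. ennreal (h x))) N = measure_of (space N) (sets N) (emeasure ?D)"
    unfolding variation_diff_def s_def
    by (simp, intro measure_of_eq) (auto simp: sets.space_closed sets.sigma_sets_eq)
  also have "\<dots> = ?D" using measure_of_of_measure[of ?D] by simp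
  finally show ?thesis .
qed

lemma weighted_dist_density:
  assumes "finite_measure N" and h: "integrable N h" and h0: "\<And>x. 0 \<le> h x"
    and [measurable]: "\<theta> \<in> borel_measurable N"
  shows "weighted_dist \<theta> (density N (\<lambda>x. ennreal (h x))) N = (\<integral>\<^sup>+x. ennreal (\<bar>h x - 1\<bar> * \<theta> x) \<partial>N)"
proof -
  have [measurable]: "h \<in> borel_measurable N" using h by auto
  show ?thesis unfolding weighted_dist_def variation_diff_density[OF assms(1-3)]
    by (subst nn_integral_density) (auto simp: ennreal_mult')
qed

lemma tv_dist_density:
  assumes "finite_measure N" and h: "integrable N h" and h0: "\<And>x. 0 \<le> h x"
  shows "tv_dist (density N (\<lambda>x. ennreal (h x))) N = (\<integral>\<^sup>+x. ennreal \<bar>h x - 1\<bar> \<partial>N) / 2"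
proof -
  have [measurable]: "h \<in> borel_measurable N" using h by auto
  show ?thesis unfolding tv_dist_def variation_diff_density[OF assms]
    by (simp add: emeasure_density cong: nn_integral_cong)
qed

section \<open>Gibbs measures, bridges and marginals\<close>

lemma sets_gibbs[simp, measurable_cong]: "sets (gibbs M F) = sets M"
  by (simp add: gibbs_def)

lemma space_gibbs[simp]: "space (gibbs M F) = space M"
  by (simp add: gibbs_def)

lemma nn_integral_gibbs:
  assumes "F \<in> borel_measurable M" "f \<in> borel_measurable M"
  shows "(\<integral>\<^sup>+x. f x \<partial>gibbs M F) = (\<integral>\<^sup>+x. ennreal (exp (- F x)) * f x \<partial>M)"
  unfolding gibbs_def using assms by (intro nn_integral_density) auto

lemma AE_gibbs:
  assumes [measurable]: "F \<in> borel_measurable M"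
  shows "(AE x in gibbs M F. P x) \<longleftrightarrow> (AE x in M. P x)"
  unfolding gibbs_def by (subst AE_density) (auto simp: ennreal_zero_less_mult_iff)

lemma sigma_finite_if_gibbs:
  assumes [measurable]: "F \<in> borel_measurable M" and "prob_space (gibbs M F)"
  shows "sigma_finite_measure M"
proof -
  interpret prob_space "gibbs M F" by fact
  have "density (gibbs M F) (\<lambda>x. ennreal (exp (F x))) = M"
    unfolding gibbs_def by (subst density_density_eq)
      (auto simp: ennreal_mult[symmetric] exp_add[symmetric] density_1)
  moreover have "sigma_finite_measure (density (gibbs M F) (\<lambda>x. ennreal (exp (F x))))"
    by (subst sigma_finite_iff_density_finite) (auto simp: gibbs_def)
  ultimately show ?thesis by simp
qed

lemma kernel_apply_exp:
  assumes [measurable]: "W x \<in> borel_measurable \<nu>" "V \<in> borel_measurable \<nu>" "f \<in> borel_measurable \<nu>"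
  shows "kernel_apply (kernel_Q \<nu> W) (\<lambda>y. exp (- f y)) x = (\<integral>y. exp (- W x y - (f y - V y)) \<partial>gibbs \<nu> V)"
  unfolding kernel_apply_def kernel_Q_def gibbs_def
  by (simp add: integral_density exp_add[symmetric])

text \<open>The identity that turns the iteration into a statement on densities: the coupling
  \<open>gibbs \<Lambda> U\<close> times the bridge has density \<open>exp (- W - a - b)\<close> with respect to the product of the Gibbs
  measures, and integrating out the first variable leaves \<open>exp (b' - b)\<close>, with \<open>b'\<close> the next potential.\<close>

lemma bridge_marginal:
  fixes \<Lambda> :: "'a measure" and \<nu> :: "'b measure"
  assumes pair: "cost_pair (gibbs \<Lambda> U) (gibbs \<nu> V) W w"
    and [measurable]: "U \<in> borel_measurable \<Lambda>" "V \<in> borel_measurable \<nu>" "f \<in> borel_measurable \<nu>"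
    and a: "normalises (gibbs \<Lambda> U) (gibbs \<nu> V) W (\<lambda>y. f y - V y) a"
    and b': "normalises (gibbs \<nu> V) (gibbs \<Lambda> U) (\<lambda>y x. W x y) a b'"
  shows "bind (gibbs \<Lambda> U) (bridge (kernel_Q \<nu> W) f)
    = density (gibbs \<nu> V) (\<lambda>y. ennreal (exp (b' y - (f y - V y))))"
proof -
  interpret cost_pair "gibbs \<Lambda> U" "gibbs \<nu> V" W w by fact
  let ?M = "gibbs \<Lambda> U" and ?N = "gibbs \<nu> V"
  let ?S = "bridge (kernel_Q \<nu> W) f"
  have [measurable]: "a \<in> borel_measurable ?M" "b' \<in> borel_measurable ?N"
    using a b' by (auto simp: normalises_def)
  have Wm[measurable]: "W x \<in> borel_measurable \<nu>" for x
    using borel_measurable_integrable[OF W_integrable[of x]] by simp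
  have fm[measurable]: "f \<in> borel_measurable ?N" "V \<in> borel_measurable ?N" by simp_all
  have fV: "(\<lambda>y. f y - V y) \<in> borel_measurable ?N" by measurable
  define Z where "Z x = (\<integral>y. exp (- W x y - (f y - V y)) \<partial>?N)" for x
  have Zm[measurable]: "Z \<in> borel_measurable ?M" unfolding Z_def by measurable
  have Z0: "0 \<le> Z x" for x unfolding Z_def by (intro integral_nonneg_AE) auto
  have S: "?S x = density ?N (\<lambda>y. ennreal (exp (- W x y - (f y - V y)) / Z x))" for x
  proof -
    have "?S x = density (density \<nu> (\<lambda>y. ennreal (exp (- W x y)))) (\<lambda>y. ennreal (exp (- f y) / Z x))"
      by (simp add: bridge_def kernel_apply_exp[where V = V and f = f] Z_def) (simp add: kernel_Q_def)
    also have "\<dots> = density \<nu> (\<lambda>y. ennreal (exp (- W x y)) * ennreal (exp (- f y) / Z x))"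
      by (rule density_density_eq) auto
    also have "\<dots> = density \<nu> (\<lambda>y. ennreal (exp (- V y)) * ennreal (exp (- W x y - (f y - V y)) / Z x))"
      using Z0 by (intro density_cong) (auto simp: ennreal_mult[symmetric] exp_add[symmetric])
    also have "\<dots> = density ?N (\<lambda>y. ennreal (exp (- W x y - (f y - V y)) / Z x))"
      unfolding gibbs_def by (rule density_density_eq[symmetric]) auto
    finally show ?thesis .
  qed
  have sets_S: "sets (?S x) = sets ?N" for x by (simp add: S)
  have em_S: "emeasure (?S x) A = (\<integral>\<^sup>+y. ennreal (exp (- W x y - (f y - V y)) / Z x) * indicator A y \<partial>?N)"
    if "A \<in> sets ?N" for x A
    unfolding S using that by (intro emeasure_density) auto
  have sub: "subprob_space (?S x)" for x
  proof (rule subprob_spaceI)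
    show "space (?S x) \<noteq> {}" using N.not_empty by (simp add: S)
    show "emeasure (?S x) (space (?S x)) \<le> 1"
    proof (cases "integrable ?N (\<lambda>y. exp (- W x y - (f y - V y)))")
      case True
      have "emeasure (?S x) (space ?N) = (\<integral>\<^sup>+y. ennreal (exp (- W x y - (f y - V y)) / Z x) \<partial>?N)"
        unfolding em_S[OF sets.top] by (auto intro!: nn_integral_cong simp: indicator_def)
      also have "\<dots> = ennreal (Z x / Z x)"
        using True Z0[of x] by (subst nn_integral_eq_integral) (auto simp: Z_def)
      also have "\<dots> \<le> 1" by (cases "Z x = 0") auto
      finally show ?thesis by (simp add: S)
    next
      case False
      then have "Z x = 0" by (simp add: Z_def not_integrable_integral_eq)
      then show ?thesis by (simp add: S emeasure_density)
    qed
  qed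
  have kern: "?S \<in> measurable ?M (subprob_algebra ?N)"
  proof (rule measurable_subprob_algebra[OF sub sets_S])
    fix A assume [measurable]: "A \<in> sets ?N"
    show "(\<lambda>x. emeasure (?S x) A) \<in> borel_measurable ?M"
      unfolding em_S[OF \<open>A \<in> sets ?N\<close>] by measurable
  qed
  show ?thesis
  proof (rule measure_eqI)
    show sets_eq: "sets (bind ?M ?S) = sets (density ?N (\<lambda>y. ennreal (exp (b' y - (f y - V y)))))"
      using M.not_empty by (subst sets_bind[OF sets_S]) auto
    fix A assume "A \<in> sets (bind ?M ?S)"
    then have A[measurable]: "A \<in> sets ?N" using sets_eq by simp
    have "emeasure (bind ?M ?S) A = (\<integral>\<^sup>+x. emeasure (?S x) A \<partial>?M)"
      using M.not_empty kern A by (rule emeasure_bind)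
    also have "\<dots> = (\<integral>\<^sup>+x. \<integral>\<^sup>+y. ennreal (exp (- W x y - a x - (f y - V y))) * indicator A y \<partial>?N \<partial>?M)"
    proof (rule nn_integral_cong_AE)
      show "AE x in ?M. emeasure (?S x) A = (\<integral>\<^sup>+y. ennreal (exp (- W x y - a x - (f y - V y))) * indicator A y \<partial>?N)"
        using normalises_integral[OF a fV]
      proof eventually_elim
        case (elim x)
        then have "Z x = exp (a x)" by (simp add: Z_def)
        then show ?case unfolding em_S[OF A]
          by (auto intro!: nn_integral_cong simp: exp_diff[symmetric] algebra_simps)
      qed
    qed
    also have "\<dots> = (\<integral>\<^sup>+y. \<integral>\<^sup>+x. ennreal (exp (- W x y - a x - (f y - V y))) * indicator A y \<partial>?M \<partial>?N)"
      by (rule P.Fubini'[symmetric]) measurable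
    also have "\<dots> = (\<integral>\<^sup>+y. ennreal (exp (b' y - (f y - V y))) * indicator A y \<partial>?N)"
    proof (rule nn_integral_cong_AE)
      have "AE y in ?N. (\<integral>\<^sup>+x. ennreal (exp (- W x y - a x)) \<partial>?M) = ennreal (exp (b' y))"
        using b' by (simp add: normalises_def)
      then show "AE y in ?N. (\<integral>\<^sup>+x. ennreal (exp (- W x y - a x - (f y - V y))) * indicator A y \<partial>?M)
          = ennreal (exp (b' y - (f y - V y))) * indicator A y"
      proof eventually_elim
        case (elim y)
        have [measurable]: "(\<lambda>x. W x y) \<in> borel_measurable ?M"
          by (rule borel_measurable_integrable[OF W_integrable'])
        have split: "ennreal (exp (t - (f y - V y))) = ennreal (exp t) * ennreal (exp (- (f y - V y)))" for t
          unfolding diff_conv_add_uminus[of t] exp_add by (rule ennreal_mult) simp_all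
        have "(\<integral>\<^sup>+x. ennreal (exp (- W x y - a x - (f y - V y))) * indicator A y \<partial>?M)
          = (\<integral>\<^sup>+x. ennreal (exp (- W x y - a x)) * (ennreal (exp (- (f y - V y))) * indicator A y) \<partial>?M)"
          by (simp only: split mult.assoc)
        also have "\<dots> = ennreal (exp (b' y)) * (ennreal (exp (- (f y - V y))) * indicator A y)"
          by (subst nn_integral_multc) (simp_all add: elim)
        finally show ?case by (simp only: split mult.assoc)
      qed
    qed
    also have "\<dots> = emeasure (density ?N (\<lambda>y. ennreal (exp (b' y - (f y - V y))))) A"
      using A by (intro emeasure_density[symmetric]) auto
    finally show "emeasure (bind ?M ?S) A = emeasure (density ?N (\<lambda>y. ennreal (exp (b' y - (f y - V y))))) A" .
  qed
qed

section \<open>Consequences of the growth condition\<close>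

text \<open>Outside the compact set \<open>\<delta> U - F \<le> - ln \<epsilon>\<close> the bound holds without the constant, and on it everything is bounded.\<close>

lemma exp_cost_small:
  fixes U F :: "'a::topological_space \<Rightarrow> real"
  assumes U: "locally_bounded U" and D: "locally_bounded (\<lambda>x. \<delta> * U x - F x)"
    and cpt: "compact_sublevels (\<lambda>x. \<delta> * U x - F x)" and \<delta>: "0 < \<delta>" and \<epsilon>: "0 < \<epsilon>"
  shows "\<exists>C. \<forall>x. exp (F x) \<le> \<epsilon> * exp (\<delta> * U x) + C"
proof -
  define K where "K = {x. \<delta> * U x - F x \<le> - ln \<epsilon>}"
  have "compact K" using cpt by (simp add: K_def compact_sublevels_def)
  then have "bounded (U ` K)" "bounded ((\<lambda>x. \<delta> * U x - F x) ` K)"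
    using U D unfolding locally_bounded_def by blast+
  then obtain B1 B2 where B: "\<And>x. x \<in> K \<Longrightarrow> \<bar>U x\<bar> \<le> B1" "\<And>x. x \<in> K \<Longrightarrow> \<bar>\<delta> * U x - F x\<bar> \<le> B2"
    unfolding bounded_iff ball_simps real_norm_def by blast
  have "exp (F x) \<le> \<epsilon> * exp (\<delta> * U x) + exp (\<delta> * B1 + B2)" for x
  proof (cases "x \<in> K")
    case True
    have "\<delta> * U x \<le> \<delta> * B1" using B(1)[OF True] \<delta> by (intro mult_left_mono) auto
    then have "F x \<le> \<delta> * B1 + B2" using B(2)[OF True] by linarith
    then have "exp (F x) \<le> exp (\<delta> * B1 + B2)" by simp
    then show ?thesis using \<epsilon> by (smt (verit) exp_gt_zero mult_pos_pos)
  next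
    case False
    then have "exp (F x) \<le> exp (\<delta> * U x + ln \<epsilon>)" by (simp add: K_def)
    also have "\<dots> = \<epsilon> * exp (\<delta> * U x)" using \<epsilon> by (simp add: exp_add)
    finally show ?thesis using exp_gt_zero[of "\<delta> * B1 + B2"] by linarith
  qed
  then show ?thesis by blast
qed

lemma bounded_below_if_compact_sublevels:
  fixes U :: "'a::topological_space \<Rightarrow> real"
  assumes "locally_bounded U" and "compact_sublevels U"
  shows "\<exists>u. \<forall>x. u \<le> U x"
proof -
  have "bounded (U ` {x. U x \<le> 0})" using assms by (simp add: locally_bounded_def compact_sublevels_def)
  then obtain B where B: "\<And>x. U x \<le> 0 \<Longrightarrow> \<bar>U x\<bar> \<le> B" by (auto simp: bounded_iff)
  have "- \<bar>B\<bar> \<le> U x" for x using B[of x] by (cases "U x \<le> 0") auto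
  then show ?thesis by blast
qed

lemma (in prob_space) sublevel_positive_measure:
  fixes U :: "'a \<Rightarrow> real"
  assumes [measurable]: "U \<in> borel_measurable M"
  shows "\<exists>r. 0 < prob {x \<in> space M. U x \<le> r}"
proof (rule ccontr)
  assume "\<not> ?thesis"
  then have "prob {x \<in> space M. U x \<le> r} = 0" for r
    using measure_nonneg[of M] by (metis antisym_conv1 not_le)
  then have "AE x in M. \<not> U x \<le> real n" for n
    by (intro AE_I[of _ _ "{x \<in> space M. U x \<le> real n}"]) (auto simp: emeasure_eq_measure)
  then have "AE x in M. \<forall>n. \<not> U x \<le> real n" by (simp add: AE_all_countable)
  then have "AE x in M. False" 
    by eventually_elim (use real_arch_simple in blast)
  then show False by simp
qed

text \<open>Both sets are sublevel sets of functions with compact sublevel sets, so their product is compact.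
  The set \<open>K\<close> is chosen before \<open>r\<close>.\<close>

lemma cost_bounded_on_sublevels:
  fixes M :: "'a::topological_space measure" and U :: "'a \<Rightarrow> real" and V :: "'b::topological_space \<Rightarrow> real"
    and W :: "'a \<Rightarrow> 'b \<Rightarrow> real"
  assumes M: "prob_space M" and sM: "sets M = sets borel" and U[measurable]: "U \<in> borel_measurable borel"
    and cU: "compact_sublevels U" and cV: "compact_sublevels V"
    and W: "locally_bounded (case_prod W)" and \<delta>: "0 < \<delta>"
  shows "\<exists>K\<in>sets M. 0 < measure M K \<and> (\<forall>r. \<exists>B. \<forall>x\<in>K. \<forall>y. exp (\<delta> * V y) \<le> r \<longrightarrow> W x y \<le> B)"
proof -
  interpret M: prob_space M by fact
  have [measurable]: "U \<in> borel_measurable M" using U measurable_cong_sets[OF sM refl] by blast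
  obtain R where R: "0 < measure M {x \<in> space M. U x \<le> R}" using M.sublevel_positive_measure[of U] by auto
  have sp: "space M = UNIV" using sets_eq_imp_space_eq[OF sM] by simp
  show ?thesis
  proof (rule bexI[of _ "{x \<in> space M. U x \<le> R}"], intro conjI allI R)
    fix r
    define L where "L = {y. V y \<le> ln r / \<delta>}"
    have "compact ({x. U x \<le> R} \<times> L)" using cU cV by (auto simp: compact_sublevels_def L_def intro: compact_Times)
    then have "bounded (case_prod W ` ({x. U x \<le> R} \<times> L))" using W by (simp add: locally_bounded_def)
    then obtain B where B: "\<And>x y. U x \<le> R \<Longrightarrow> y \<in> L \<Longrightarrow> \<bar>W x y\<bar> \<le> B" unfolding bounded_iff by force
    have "y \<in> L" if "exp (\<delta> * V y) \<le> r" for y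
    proof -
      have "0 < r" using that exp_gt_zero[of "\<delta> * V y"] by linarith
      then have "\<delta> * V y \<le> ln r" using that by (simp add: ln_ge_iff)
      then show ?thesis using \<delta> by (simp add: L_def field_simps)
    qed
    then have "\<forall>x\<in>{x \<in> space M. U x \<le> R}. \<forall>y. exp (\<delta> * V y) \<le> r \<longrightarrow> W x y \<le> B"
      using B by (force dest: abs_le_D1)
    then show "\<exists>B. \<forall>x\<in>{x \<in> space M. U x \<le> R}. \<forall>y. exp (\<delta> * V y) \<le> r \<longrightarrow> W x y \<le> B" by blast
  qed simp
qed

lemma weighted_exp_cost_integrable:
  fixes U F :: "'a \<Rightarrow> real"
  assumes [measurable]: "U \<in> borel_measurable \<Lambda>" "F \<in> borel_measurable \<Lambda>"
    and fin: "(\<integral>\<^sup>+x. ennreal (exp (F x)) \<partial>gibbs \<Lambda> (\<lambda>x. (1 - \<delta>) * U x)) < \<infinity>"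
    and u: "\<And>x. u \<le> U x" and \<delta>: "0 < \<delta>"
  shows "integrable (gibbs \<Lambda> U) (\<lambda>x. exp (\<delta> * U x) * exp (F x))"
    and "integrable (gibbs \<Lambda> U) (\<lambda>x. exp (F x))"
proof -
  have "(\<integral>\<^sup>+x. ennreal (exp (\<delta> * U x) * exp (F x)) \<partial>gibbs \<Lambda> U)
      = (\<integral>\<^sup>+x. ennreal (exp (F x)) \<partial>gibbs \<Lambda> (\<lambda>x. (1 - \<delta>) * U x))"
    by (subst (1 2) nn_integral_gibbs)
      (auto intro!: nn_integral_cong simp: ennreal_mult[symmetric] exp_add[symmetric] algebra_simps)
  then show 1: "integrable (gibbs \<Lambda> U) (\<lambda>x. exp (\<delta> * U x) * exp (F x))"
    using fin by (intro integrableI_nonneg) (auto simp: gibbs_def)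
  show "integrable (gibbs \<Lambda> U) (\<lambda>x. exp (F x))"
  proof (rule Bochner_Integration.integrable_bound)
    show "integrable (gibbs \<Lambda> U) (\<lambda>x. exp (- (\<delta> * u)) * (exp (\<delta> * U x) * exp (F x)))" using 1 by simp
    have "exp (F x) \<le> exp (- (\<delta> * u)) * (exp (\<delta> * U x) * exp (F x))" for x
      using mult_left_mono[OF u[of x], of \<delta>] \<delta> by (simp add: exp_add[symmetric])
    then show "AE x in gibbs \<Lambda> U. norm (exp (F x)) \<le> norm (exp (- (\<delta> * u)) * (exp (\<delta> * U x) * exp (F x)))"
      by (auto simp: abs_mult)
  qed (simp add: gibbs_def)
qed

lemma cost_essentially_bounded_below:
  assumes "sigma_finite_measure \<Lambda>" "sigma_finite_measure \<nu>"
    and [measurable]: "case_prod W \<in> borel_measurable (\<Lambda> \<Otimes>\<^sub>M \<nu>)"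
    and "essentially_bounded (\<Lambda> \<Otimes>\<^sub>M \<nu>) (\<lambda>(x, y). exp (- W x y))"
  shows "\<exists>w. (AE x in \<Lambda>. AE y in \<nu>. - w \<le> W x y) \<and> (AE y in \<nu>. AE x in \<Lambda>. - w \<le> W x y)"
proof -
  interpret pair_sigma_finite \<Lambda> \<nu> using assms by (simp add: pair_sigma_finite_def)
  obtain C where C: "AE p in \<Lambda> \<Otimes>\<^sub>M \<nu>. \<bar>case p of (x, y) \<Rightarrow> exp (- W x y)\<bar> \<le> C"
    using assms by (auto simp: essentially_bounded_def)
  define w where "w = ln (max 1 C)"
  have "AE p in \<Lambda> \<Otimes>\<^sub>M \<nu>. - w \<le> case_prod W p"
    using C
  proof eventually_elim
    case (elim p)
    then have "exp (- case_prod W p) \<le> exp w" by (auto simp: w_def split: prod.splits)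
    then show ?case by simp
  qed
  then have 1: "AE x in \<Lambda>. AE y in \<nu>. - w \<le> W x y" using AE_pair[of "\<lambda>p. - w \<le> case_prod W p"] by simp
  moreover have "(AE x in \<Lambda>. AE y in \<nu>. - w \<le> W x y) \<longleftrightarrow> (AE y in \<nu>. AE x in \<Lambda>. - w \<le> W x y)"
    by (rule AE_commute) measurable
  ultimately show ?thesis by blast
qed

section \<open>Exponential convergence of the marginals\<close>

lemma sinkhorn_pot_measurable:
  assumes [measurable]: "U \<in> borel_measurable \<Lambda>" "V \<in> borel_measurable \<nu>" "case_prod W \<in> borel_measurable (\<Lambda> \<Otimes>\<^sub>M \<nu>)"
    and W1: "\<And>x. W x \<in> borel_measurable \<nu>" and W2: "\<And>y. (\<lambda>x. W x y) \<in> borel_measurable \<Lambda>"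
    and s\<Lambda>: "prob_space (gibbs \<Lambda> U)" and s\<nu>: "prob_space (gibbs \<nu> V)"
  shows "pot_U \<Lambda> \<nu> U V W n \<in> borel_measurable \<Lambda> \<and> pot_V \<Lambda> \<nu> U V W n \<in> borel_measurable \<nu>"
proof -
  interpret M: prob_space "gibbs \<Lambda> U" by fact
  interpret N: prob_space "gibbs \<nu> V" by fact
  have W_sw[measurable]: "(\<lambda>(y, x). W x y) \<in> borel_measurable (\<nu> \<Otimes>\<^sub>M \<Lambda>)"
    using measurable_pair_swap[OF assms(3)] by (simp add: split_beta')
  show ?thesis
  proof (induction n)
    case 0
    then show ?case by (simp add: pot_0)
  next
    case (Suc n)
    then have m[measurable]: "pot_U \<Lambda> \<nu> U V W n \<in> borel_measurable \<Lambda>" "pot_V \<Lambda> \<nu> U V W n \<in> borel_measurable \<nu>" by auto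
    have R: "kernel_apply (kernel_R \<Lambda> W) (\<lambda>x. exp (- pot_U \<Lambda> \<nu> U V W n x)) y
        = (\<integral>x. exp (- W x y - (pot_U \<Lambda> \<nu> U V W n x - U x)) \<partial>gibbs \<Lambda> U)" for y
      using kernel_apply_exp[OF W2 assms(1) m(1)] by (simp add: kernel_R_def kernel_Q_def kernel_apply_def)
    note Q = kernel_apply_exp[where W = W and f = "pot_V \<Lambda> \<nu> U V W n", OF W1 assms(2) m(2)]
    have 1: "(\<lambda>y. V y + ln (\<integral>x. exp (- W x y - (pot_U \<Lambda> \<nu> U V W n x - U x)) \<partial>gibbs \<Lambda> U)) \<in> borel_measurable \<nu>"
      by measurable
    have 2: "(\<lambda>x. U x + ln (\<integral>y. exp (- W x y - (pot_V \<Lambda> \<nu> U V W n y - V y)) \<partial>gibbs \<nu> V)) \<in> borel_measurable \<Lambda>"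
      by measurable
    show ?case using m 1 2 unfolding R[symmetric] Q[symmetric]
      by (cases "even n") (simp_all add: pot_U_def pot_V_def split_beta Let_def)
  qed
qed

text \<open>The contracting norm has weight \<open>1 + \<beta> \<theta>\<close>, which is equivalent to \<open>\<theta>\<close> as \<open>\<theta>\<close> is bounded away from 0.\<close>

lemma norm_comparison:
  fixes F \<theta> :: "'a \<Rightarrow> real"
  assumes [measurable]: "F \<in> borel_measurable N" "\<theta> \<in> borel_measurable N"
    and \<theta>: "\<And>x. l \<le> \<theta> x" "0 < l" and \<beta>: "0 < \<beta>"
  defines "I \<equiv> (\<integral>\<^sup>+x. ennreal (\<bar>F x\<bar> * \<theta> x) \<partial>N)"
    and "J \<equiv> (\<integral>\<^sup>+x. ennreal (\<bar>F x\<bar> * (1 + \<beta> * \<theta> x)) \<partial>N)"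
  shows "ennreal \<beta> * I \<le> J" and "J \<le> ennreal (1 / l + \<beta>) * I" and "(\<integral>\<^sup>+x. ennreal \<bar>F x\<bar> \<partial>N) \<le> ennreal (1 / l) * I"
proof -
  have t0: "0 \<le> \<theta> x" for x using \<theta>(1)[of x] \<theta>(2) by linarith
  have "ennreal \<beta> * I = (\<integral>\<^sup>+x. ennreal \<beta> * ennreal (\<bar>F x\<bar> * \<theta> x) \<partial>N)"
    unfolding I_def by (simp add: nn_integral_cmult)
  also have "\<dots> \<le> J" unfolding J_def using \<beta> t0
    by (intro nn_integral_mono) (auto simp: ennreal_mult[symmetric] algebra_simps intro!: ennreal_leI)
  finally show "ennreal \<beta> * I \<le> J" .
  have "J \<le> (\<integral>\<^sup>+x. ennreal (1 / l + \<beta>) * ennreal (\<bar>F x\<bar> * \<theta> x) \<partial>N)"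
    unfolding J_def
  proof (rule nn_integral_mono)
    fix x
    have "1 \<le> \<theta> x / l" using \<theta>(1)[of x] \<theta>(2) by simp
    then have "1 + \<beta> * \<theta> x \<le> (1 / l + \<beta>) * \<theta> x" by (simp add: algebra_simps)
    then have "\<bar>F x\<bar> * (1 + \<beta> * \<theta> x) \<le> \<bar>F x\<bar> * ((1 / l + \<beta>) * \<theta> x)" by (intro mult_left_mono) auto
    then show "ennreal (\<bar>F x\<bar> * (1 + \<beta> * \<theta> x)) \<le> ennreal (1 / l + \<beta>) * ennreal (\<bar>F x\<bar> * \<theta> x)"
      using \<theta>(2) \<beta> t0 by (subst ennreal_mult[symmetric]) (auto intro!: ennreal_leI simp: mult_ac)
  qed
  then show "J \<le> ennreal (1 / l + \<beta>) * I" unfolding I_def by (simp add: nn_integral_cmult)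
  have "(\<integral>\<^sup>+x. ennreal \<bar>F x\<bar> \<partial>N) \<le> (\<integral>\<^sup>+x. ennreal (1 / l) * ennreal (\<bar>F x\<bar> * \<theta> x) \<partial>N)"
  proof (rule nn_integral_mono)
    fix x
    have "\<bar>F x\<bar> * 1 \<le> \<bar>F x\<bar> * (\<theta> x / l)" using \<theta>(1)[of x] \<theta>(2) by (intro mult_left_mono) auto
    then show "ennreal \<bar>F x\<bar> \<le> ennreal (1 / l) * ennreal (\<bar>F x\<bar> * \<theta> x)"
      using \<theta>(2) t0 by (subst ennreal_mult[symmetric]) (auto intro!: ennreal_leI)
  qed
  then show "(\<integral>\<^sup>+x. ennreal \<bar>F x\<bar> \<partial>N) \<le> ennreal (1 / l) * I" unfolding I_def by (simp add: nn_integral_cmult)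
qed

lemma weighted_decay:
  fixes F :: "nat \<Rightarrow> 'a \<Rightarrow> real"
  assumes "finite_measure N"
    and \<pi>: "\<And>n. 1 \<le> n \<Longrightarrow> \<pi> n = density N (\<lambda>x. ennreal (F n x))"
    and F_int: "\<And>n. 1 \<le> n \<Longrightarrow> integrable N (F n)" and F0: "\<And>n x. 0 \<le> F n x"
    and [measurable]: "\<theta> \<in> borel_measurable N"
    and \<theta>: "\<And>x. l \<le> \<theta> x" "0 < l" and \<beta>: "0 < \<beta>" and \<rho>: "0 \<le> \<rho>"
    and fin: "\<And>n. 1 \<le> n \<Longrightarrow> integrable N (\<lambda>x. \<bar>F n x - 1\<bar> * \<theta> x)"
    and step: "\<And>n. 1 \<le> n \<Longrightarrow> (\<integral>\<^sup>+x. ennreal (\<bar>F (Suc n) x - 1\<bar> * (1 + \<beta> * \<theta> x)) \<partial>N)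
      \<le> ennreal \<rho> * (\<integral>\<^sup>+x. ennreal (\<bar>F n x - 1\<bar> * (1 + \<beta> * \<theta> x)) \<partial>N)"
    and c1: "1 / l \<le> c1" and c2: "c1 * (1 / l + \<beta>) / \<beta> \<le> c2" and n: "1 \<le> n"
  shows "weighted_dist \<theta> (\<pi> n) N < \<infinity> \<and>
    tv_dist (\<pi> n) N \<le> ennreal c1 * weighted_dist \<theta> (\<pi> n) N \<and>
    ennreal c1 * weighted_dist \<theta> (\<pi> n) N \<le> ennreal (c2 * \<rho> ^ (n - 1)) * weighted_dist \<theta> (\<pi> 1) N"
proof -
  define I where "I n = (\<integral>\<^sup>+x. ennreal (\<bar>F n x - 1\<bar> * \<theta> x) \<partial>N)" for n
  define J where "J n = (\<integral>\<^sup>+x. ennreal (\<bar>F n x - 1\<bar> * (1 + \<beta> * \<theta> x)) \<partial>N)" for n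
  have t0: "0 \<le> \<theta> x" for x using \<theta>(1)[of x] \<theta>(2) by linarith
  have wd: "weighted_dist \<theta> (\<pi> m) N = I m" if "1 \<le> m" for m
    unfolding I_def \<pi>[OF that] using F_int[OF that] F0 assms(1) by (intro weighted_dist_density) auto
  have c1_pos: "0 < c1" using c1 \<theta>(2) by (metis less_le_trans zero_less_divide_1_iff)
  have cmp: "ennreal \<beta> * I m \<le> J m" "J m \<le> ennreal (1 / l + \<beta>) * I m"
    "(\<integral>\<^sup>+x. ennreal \<bar>F m x - 1\<bar> \<partial>N) \<le> ennreal (1 / l) * I m" if "1 \<le> m" for m
    unfolding I_def J_def using F_int[OF that] \<theta> \<beta>
    by (intro norm_comparison; simp)+
  have "tv_dist (\<pi> n) N = (\<integral>\<^sup>+x. ennreal \<bar>F n x - 1\<bar> \<partial>N) / 2"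
    unfolding \<pi>[OF n] using F_int[OF n] F0 assms(1) by (intro tv_dist_density) auto
  also have "\<dots> \<le> (\<integral>\<^sup>+x. ennreal \<bar>F n x - 1\<bar> \<partial>N)"
    (is "?t / 2 \<le> ?t")
  proof (cases ?t)
    case (real r)
    then show ?thesis using divide_ennreal[of r 2] by simp
  qed simp
  also have "\<dots> \<le> ennreal c1 * I n"
    using cmp(3)[OF n] mult_right_mono[OF ennreal_leI[OF c1], of "I n"] by simp
  finally have tv: "tv_dist (\<pi> n) N \<le> ennreal c1 * I n" .
  have "I n < \<infinity>"
    unfolding I_def using fin[OF n] t0 by (subst nn_integral_eq_integral) auto
  moreover have "ennreal c1 * I n \<le> ennreal (c2 * \<rho> ^ (n - 1)) * I 1"
  proof -
    have "J (Suc (0 + (n - 1))) \<le> ennreal (\<rho> ^ (n - 1)) * J (Suc 0)"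
      using geometric_decay[of "\<lambda>n. J (Suc n)" \<rho> 0 "n - 1"] step \<rho> by (simp add: J_def)
    then have J: "J n \<le> ennreal (\<rho> ^ (n - 1)) * J 1" using n by simp
    have "ennreal c1 * I n = ennreal (c1 / \<beta>) * (ennreal \<beta> * I n)"
      using \<beta> c1_pos by (simp add: mult.assoc[symmetric] ennreal_mult[symmetric])
    also have "\<dots> \<le> ennreal (c1 / \<beta>) * (ennreal (\<rho> ^ (n - 1)) * (ennreal (1 / l + \<beta>) * I 1))"
    proof (rule mult_left_mono)
      show "ennreal \<beta> * I n \<le> ennreal (\<rho> ^ (n - 1)) * (ennreal (1 / l + \<beta>) * I 1)"
        using cmp(1)[OF n] J mult_left_mono[OF cmp(2)[OF order_refl], of "ennreal (\<rho> ^ (n - 1))"]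
        by (meson order_trans zero_le)
    qed simp
    also have "\<dots> = ennreal ((c1 * (1 / l + \<beta>) / \<beta>) * \<rho> ^ (n - 1)) * I 1"
    proof -
      have nn: "0 \<le> c1 / \<beta>" "0 \<le> \<rho> ^ (n - 1)" "0 \<le> 1 / l + \<beta>" using \<beta> c1_pos \<theta>(2) \<rho> by simp_all
      have eq: "c1 * (1 / l + \<beta>) / \<beta> * \<rho> ^ (n - 1) = c1 / \<beta> * (\<rho> ^ (n - 1) * (1 / l + \<beta>))" by simp
      show ?thesis unfolding eq using nn by (simp only: ennreal_mult mult_nonneg_nonneg mult.assoc)
    qed
    also have "\<dots> \<le> ennreal (c2 * \<rho> ^ (n - 1)) * I 1"
      using c2 \<rho> by (intro mult_right_mono ennreal_leI) auto
    finally show ?thesis .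
  qed
  ultimately show ?thesis using tv unfolding wd[OF n] wd[OF order_refl] by simp
qed

theorem corollary4p9:
  fixes \<Lambda> :: "'a::polish_space measure" and \<nu> :: "'b::polish_space measure"
    and U :: "'a \<Rightarrow> real" and V :: "'b \<Rightarrow> real" and W :: "'a \<Rightarrow> 'b \<Rightarrow> real"
    and \<delta> :: real
  assumes "locally compact (UNIV :: 'a set)" and "locally compact (UNIV :: 'b set)"
    and "sets \<Lambda> = sets borel" and "sets \<nu> = sets borel"
    and "finite_on_compacts \<Lambda>" and "finite_on_compacts \<nu>"
    and "U \<in> borel_measurable borel" and "V \<in> borel_measurable borel"
    and "case_prod W \<in> borel_measurable (borel \<Otimes>\<^sub>M borel)"
    and "prob_space (gibbs \<Lambda> U)" and "prob_space (gibbs \<nu> V)"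
    and "\<And>x. prob_space (kernel_Q \<nu> W x)"
    and "finite_entropy_coupling (gibbs \<Lambda> U) (gibbs \<nu> V) (kernel_Q \<nu> W)"
    and "locally_bounded U" and "locally_bounded V" and "locally_bounded (case_prod W)"
    and "essentially_bounded (\<Lambda> \<Otimes>\<^sub>M \<nu>) (\<lambda>(x, y). exp (- W x y))"
    and "compact_sublevels U" and "compact_sublevels V"
    and "0 < \<delta>" and "\<delta> \<le> 1"
    and "H_cond \<Lambda> \<nu> U V W \<delta>"
  defines "\<phi> \<equiv> \<lambda>x. exp (\<delta> * U x)" and "\<psi> \<equiv> \<lambda>y. exp (\<delta> * V y)"
  shows "\<exists>(n\<^sub>0::nat) (\<rho>::real) (c\<^sub>1::real) (c\<^sub>2::real).
    0 \<le> \<rho> \<and> \<rho> < 1 \<and> 0 \<le> c\<^sub>1 \<and> 0 \<le> c\<^sub>2 \<and>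
    (\<forall>n\<ge>n\<^sub>0.
      weighted_dist \<psi> (pi_even \<Lambda> \<nu> U V W n) (gibbs \<nu> V) < \<infinity> \<and>
      tv_dist (pi_even \<Lambda> \<nu> U V W n) (gibbs \<nu> V)
        \<le> ennreal c\<^sub>1 * weighted_dist \<psi> (pi_even \<Lambda> \<nu> U V W n) (gibbs \<nu> V) \<and>
      ennreal c\<^sub>1 * weighted_dist \<psi> (pi_even \<Lambda> \<nu> U V W n) (gibbs \<nu> V)
        \<le> ennreal (c\<^sub>2 * \<rho> ^ (n - n\<^sub>0)) * weighted_dist \<psi> (pi_even \<Lambda> \<nu> U V W n\<^sub>0) (gibbs \<nu> V) \<and>
      weighted_dist \<phi> (pi_odd \<Lambda> \<nu> U V W n) (gibbs \<Lambda> U) < \<infinity> \<and>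
      tv_dist (pi_odd \<Lambda> \<nu> U V W n) (gibbs \<Lambda> U)
        \<le> ennreal c\<^sub>1 * weighted_dist \<phi> (pi_odd \<Lambda> \<nu> U V W n) (gibbs \<Lambda> U) \<and>
      ennreal c\<^sub>1 * weighted_dist \<phi> (pi_odd \<Lambda> \<nu> U V W n) (gibbs \<Lambda> U)
        \<le> ennreal (c\<^sub>2 * \<rho> ^ (n - n\<^sub>0)) * weighted_dist \<phi> (pi_odd \<Lambda> \<nu> U V W n\<^sub>0) (gibbs \<Lambda> U))"
proof -
  note c\<Lambda> = assms(3) and c\<nu> = assms(4) and U = assms(7) and V = assms(8) and W = assms(9)
  note pM = assms(10) and pN = assms(11) and pQ = assms(12)
  note lbU = assms(14) and lbV = assms(15) and lbW = assms(16) and ess = assms(17)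
  note csU = assms(18) and csV = assms(19) and \<delta> = assms(20) and H = assms(22)
  let ?M = "gibbs \<Lambda> U" and ?N = "gibbs \<nu> V" and ?W' = "\<lambda>y x. W x y"
  interpret M: prob_space ?M by (rule pM)
  interpret N: prob_space ?N by (rule pN)
  have Um[measurable]: "U \<in> borel_measurable \<Lambda>" and Vm[measurable]: "V \<in> borel_measurable \<nu>"
    using U V measurable_cong_sets[OF c\<Lambda> refl] measurable_cong_sets[OF c\<nu> refl] by auto
  have Wm[measurable]: "case_prod W \<in> borel_measurable (\<Lambda> \<Otimes>\<^sub>M \<nu>)"
    using W measurable_cong_sets[OF sets_pair_measure_cong[OF c\<Lambda> c\<nu>] refl] by auto
  have W_sw[measurable]: "case_prod ?W' \<in> borel_measurable (\<nu> \<Otimes>\<^sub>M \<Lambda>)"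
    using measurable_pair_swap[OF Wm] by (simp add: split_beta')
  have F_eq: "mean_cost ?N W = cost_V \<nu> V W" and G_eq: "mean_cost ?M ?W' = cost_U \<Lambda> U W"
    by (auto simp: mean_cost_def cost_V_def cost_U_def)
  have Fm[measurable]: "mean_cost ?N W \<in> borel_measurable \<Lambda>" unfolding mean_cost_def by measurable
  have Gm[measurable]: "mean_cost ?M ?W' \<in> borel_measurable \<nu>" unfolding mean_cost_def by measurable
  obtain u where u: "\<And>x. u \<le> U x" using bounded_below_if_compact_sublevels[OF lbU csU] by blast
  obtain v where v: "\<And>y. v \<le> V y" using bounded_below_if_compact_sublevels[OF lbV csV] by blast
  obtain w where w: "AE x in \<Lambda>. AE y in \<nu>. - w \<le> W x y" "AE y in \<nu>. AE x in \<Lambda>. - w \<le> W x y"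
    using cost_essentially_bounded_below[OF sigma_finite_if_gibbs[OF Um pM] sigma_finite_if_gibbs[OF Vm pN] Wm ess]
    by blast
  have Hint: "\<And>x. integrable ?N (W x)" "\<And>y. integrable ?M (?W' y)"
    and Hlb: "locally_bounded (\<lambda>x. \<delta> * U x - mean_cost ?N W x)" "locally_bounded (\<lambda>y. \<delta> * V y - mean_cost ?M ?W' y)"
    and Hcs: "compact_sublevels (\<lambda>x. \<delta> * U x - mean_cost ?N W x)" "compact_sublevels (\<lambda>y. \<delta> * V y - mean_cost ?M ?W' y)"
    and Hfin: "(\<integral>\<^sup>+x. ennreal (exp (mean_cost ?N W x)) \<partial>gibbs \<Lambda> (\<lambda>x. (1 - \<delta>) * U x)) < \<infinity>"
      "(\<integral>\<^sup>+y. ennreal (exp (mean_cost ?M ?W' y)) \<partial>gibbs \<nu> (\<lambda>y. (1 - \<delta>) * V y)) < \<infinity>"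
    using H unfolding H_cond_def F_eq G_eq by auto
  note mF = weighted_exp_cost_integrable[OF Um Fm Hfin(1) u \<delta>]
  note mG = weighted_exp_cost_integrable[OF Vm Gm Hfin(2) v \<delta>]
  have Wm_sections: "W x \<in> borel_measurable \<nu>" "?W' y \<in> borel_measurable \<Lambda>" for x y
    using borel_measurable_integrable[OF Hint(1)[of x]] borel_measurable_integrable[OF Hint(2)[of y]] by simp_all
  have pair: "cost_pair ?M ?N W w"
  proof
    show "AE x in ?M. AE y in ?N. - w \<le> W x y" using w(1) by (simp add: AE_gibbs)
    show "AE y in ?N. AE x in ?M. - w \<le> W x y" using w(2) by (simp add: AE_gibbs)
  qed (use Hint mF mG in \<open>auto\<close>)
  interpret weighted_cost_pair ?M ?N W w \<phi> \<psi>
  proof (intro weighted_cost_pair.intro pair weighted_cost_pair_axioms.intro)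
    show "\<exists>K\<in>sets ?M. 0 < measure ?M K \<and> (\<forall>r. \<exists>B. \<forall>x\<in>K. \<forall>y. \<psi> y \<le> r \<longrightarrow> W x y \<le> B)"
      unfolding \<psi>_def 
      by (rule cost_bounded_on_sublevels[OF pM _ U csU csV lbW \<delta>]) (simp add: c\<Lambda>)
    have "locally_bounded (case_prod ?W')"
      unfolding locally_bounded_def
    proof (intro allI impI)
      fix K :: "('b \<times> 'a) set" assume "compact K"
      then have "compact (prod.swap ` K)" by (intro compact_continuous_image continuous_intros)
      then have "bounded (case_prod W ` (prod.swap ` K))" using lbW by (simp add: locally_bounded_def)
      then show "bounded (case_prod ?W' ` K)" by (simp add: image_image split_beta')
    qed
    then show "\<exists>L\<in>sets ?N. 0 < measure ?N L \<and> (\<forall>r. \<exists>B. \<forall>y\<in>L. \<forall>x. \<phi> x \<le> r \<longrightarrow> W x y \<le> B)"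
      unfolding \<phi>_def
      by (rule cost_bounded_on_sublevels[OF pN _ V csV csU _ \<delta>, rotated]) (simp add: c\<nu>)
  qed (use mF mG exp_cost_small[OF lbU Hlb(1) Hcs(1) \<delta>] exp_cost_small[OF lbV Hlb(2) Hcs(2) \<delta>] in
      \<open>auto simp: \<phi>_def \<psi>_def\<close>)
  define a where "a n x = pot_U \<Lambda> \<nu> U V W (2 * n) x - U x" for n x
  define b where "b n y = pot_V \<Lambda> \<nu> U V W (2 * n) y - V y" for n y
  note pot_m = sinkhorn_pot_measurable[OF Um Vm Wm Wm_sections pM pN]
  have R_eq: "kernel_R \<Lambda> W = kernel_Q \<Lambda> ?W'" by (auto simp: kernel_R_def kernel_Q_def)
  have a0: "a 0 = (\<lambda>_. 0)" by (auto simp: a_def pot_0)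
  have b_Suc: "b (Suc n) = soft_transform ?M ?W' (a n)" for n
    using pot_odd(2,3)[of \<Lambda> \<nu> U V W n]
      kernel_apply_exp[where W = ?W' and \<nu> = \<Lambda> and V = U and f = "pot_U \<Lambda> \<nu> U V W (2 * n)"] pot_m Wm_sections
    by (auto simp: b_def a_def soft_transform_def R_eq fun_eq_iff)
  have a_Suc: "a (Suc n) = soft_transform ?N W (b (Suc n))" for n
    using pot_even[of \<nu> W \<Lambda> U V "Suc n", OF pQ]
      kernel_apply_exp[where W = W and \<nu> = \<nu> and V = V and f = "pot_V \<Lambda> \<nu> U V W (2 * Suc n)"] pot_m Wm_sections
    unfolding a_def b_def soft_transform_def fun_eq_iff by simp
  obtain \<beta> \<rho> where \<beta>: "0 < \<beta>" and \<rho>: "0 \<le> \<rho>" "\<rho> < 1"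
    and nb: "\<And>n. normalises ?N ?M ?W' (a n) (b (Suc n))" and na: "\<And>n. normalises ?M ?N W (b (Suc n)) (a (Suc n))"
    and fin_a: "\<And>n. integrable ?M (\<lambda>x. \<bar>exp (a (Suc n) x - a n x) - 1\<bar> * \<phi> x)"
    and fin_b: "\<And>n. integrable ?N (\<lambda>y. \<bar>exp (b (Suc (Suc n)) y - b (Suc n) y) - 1\<bar> * \<psi> y)"
    and step_a: "\<And>n. (\<integral>\<^sup>+x. ennreal (\<bar>exp (a (Suc (Suc n)) x - a (Suc n) x) - 1\<bar> * (1 + \<beta> * \<phi> x)) \<partial>?M)
      \<le> ennreal \<rho> * (\<integral>\<^sup>+x. ennreal (\<bar>exp (a (Suc n) x - a n x) - 1\<bar> * (1 + \<beta> * \<phi> x)) \<partial>?M)"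
    and step_b: "\<And>n. (\<integral>\<^sup>+y. ennreal (\<bar>exp (b (Suc (Suc (Suc n))) y - b (Suc (Suc n)) y) - 1\<bar> * (1 + \<beta> * \<psi> y)) \<partial>?N)
      \<le> ennreal \<rho> * (\<integral>\<^sup>+y. ennreal (\<bar>exp (b (Suc (Suc n)) y - b (Suc n) y) - 1\<bar> * (1 + \<beta> * \<psi> y)) \<partial>?N)"
    using sinkhorn_contraction[OF a0 b_Suc a_Suc] by blast
  \<comment> \<open>One lower bound for both weights, so that the same \<open>c1\<close> and \<open>c2\<close> serve on both spaces.\<close>
  define l where "l = exp (\<delta> * min u v)"
  have l: "0 < l" "l \<le> \<phi> x" "l \<le> \<psi> y" for x y
    using u[of x] v[of y] \<delta> by (auto simp: l_def \<phi>_def \<psi>_def intro!: mult_left_mono)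
  have am: "a n \<in> borel_measurable ?M" and bm: "b n \<in> borel_measurable ?N" for n
    using pot_m[of "2 * n"] Um Vm by (auto simp: a_def[abs_def] b_def[abs_def])
  define c1 where "c1 = 1 / l"
  define c2 where "c2 = c1 * (1 / l + \<beta>) / \<beta>"
  interpret S: cost_pair ?N ?M ?W' w by (rule swap)
  have pi_even: "pi_even \<Lambda> \<nu> U V W (Suc n) = density ?N (\<lambda>y. ennreal (exp (b (Suc (Suc n)) y - b (Suc n) y)))" for n
    using bridge_marginal[OF pair Um Vm, of "pot_V \<Lambda> \<nu> U V W (2 * Suc n)"] pot_m na[of n] nb[of "Suc n"]
    unfolding pi_even_def S_even_def b_def by blast
  have pi_odd: "pi_odd \<Lambda> \<nu> U V W n = density ?M (\<lambda>x. ennreal (exp (a (Suc n) x - a n x)))" for n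
    using bridge_marginal[OF swap Vm Um, of "pot_U \<Lambda> \<nu> U V W (2 * n)"] pot_m nb[of n] na[of n]
    unfolding pi_odd_def S_odd_def a_def pot_odd(1) R_eq by blast
  have even: "weighted_dist \<psi> (pi_even \<Lambda> \<nu> U V W n) ?N < \<infinity> \<and>
      tv_dist (pi_even \<Lambda> \<nu> U V W n) ?N \<le> ennreal c1 * weighted_dist \<psi> (pi_even \<Lambda> \<nu> U V W n) ?N \<and>
      ennreal c1 * weighted_dist \<psi> (pi_even \<Lambda> \<nu> U V W n) ?N
        \<le> ennreal (c2 * \<rho> ^ (n - 1)) * weighted_dist \<psi> (pi_even \<Lambda> \<nu> U V W 1) ?N" if "1 \<le> n" for n
  proof (rule weighted_decay[where F = "\<lambda>n y. exp (b (Suc n) y - b n y)" and l = l and \<beta> = \<beta>])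
    fix m :: nat assume "1 \<le> m"
    then obtain k where k: "m = Suc k" by (cases m) auto
    show "pi_even \<Lambda> \<nu> U V W m = density ?N (\<lambda>x. ennreal (exp (b (Suc m) x - b m x)))"
      unfolding k by (rule pi_even)
    show "integrable ?N (\<lambda>y. exp (b (Suc m) y - b m y))"
      unfolding k by (rule marginal_density_integrable(1)[OF na nb bm])
    show "integrable ?N (\<lambda>x. \<bar>exp (b (Suc m) x - b m x) - 1\<bar> * \<psi> x)" unfolding k by (rule fin_b)
    show "(\<integral>\<^sup>+x. ennreal (\<bar>exp (b (Suc (Suc m)) x - b (Suc m) x) - 1\<bar> * (1 + \<beta> * \<psi> x)) \<partial>?N)
      \<le> ennreal \<rho> * (\<integral>\<^sup>+x. ennreal (\<bar>exp (b (Suc m) x - b m x) - 1\<bar> * (1 + \<beta> * \<psi> x)) \<partial>?N)"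
      unfolding k by (rule step_b)
  qed (use that l \<beta> \<rho> N.finite_measure_axioms \<psi>_measurable in \<open>auto simp: c1_def c2_def\<close>)
  have odd: "weighted_dist \<phi> (pi_odd \<Lambda> \<nu> U V W n) ?M < \<infinity> \<and>
      tv_dist (pi_odd \<Lambda> \<nu> U V W n) ?M \<le> ennreal c1 * weighted_dist \<phi> (pi_odd \<Lambda> \<nu> U V W n) ?M \<and>
      ennreal c1 * weighted_dist \<phi> (pi_odd \<Lambda> \<nu> U V W n) ?M
        \<le> ennreal (c2 * \<rho> ^ (n - 1)) * weighted_dist \<phi> (pi_odd \<Lambda> \<nu> U V W 1) ?M" if "1 \<le> n" for n
  proof (rule weighted_decay[where F = "\<lambda>n x. exp (a (Suc n) x - a n x)" and l = l and \<beta> = \<beta>])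
    fix m :: nat
    show "integrable ?M (\<lambda>x. exp (a (Suc m) x - a m x))"
      by (rule S.marginal_density_integrable(1)[OF nb na am])
  qed (use that l \<beta> \<rho> M.finite_measure_axioms \<phi>_measurable pi_odd fin_a step_a in \<open>auto simp: c1_def c2_def\<close>)
  have c: "0 \<le> c1" "0 \<le> c2" using l(1) \<beta> by (auto simp: c1_def c2_def)
  show ?thesis
  proof (rule exI[of _ 1], rule exI[of _ \<rho>], rule exI[of _ c1], rule exI[of _ c2],
      intro conjI allI impI \<rho> c)
    fix n :: nat assume n: "1 \<le> n"
    note e = even[OF n] and o = odd[OF n]
    show "weighted_dist \<psi> (pi_even \<Lambda> \<nu> U V W n) ?N < \<infinity>"
      and "tv_dist (pi_even \<Lambda> \<nu> U V W n) ?N \<le> ennreal c1 * weighted_dist \<psi> (pi_even \<Lambda> \<nu> U V W n) ?N"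
      and "ennreal c1 * weighted_dist \<psi> (pi_even \<Lambda> \<nu> U V W n) ?N
        \<le> ennreal (c2 * \<rho> ^ (n - 1)) * weighted_dist \<psi> (pi_even \<Lambda> \<nu> U V W 1) ?N"
      by (rule e[THEN conjunct1], rule e[THEN conjunct2, THEN conjunct1], rule e[THEN conjunct2, THEN conjunct2])
    show "weighted_dist \<phi> (pi_odd \<Lambda> \<nu> U V W n) ?M < \<infinity>"
      and "tv_dist (pi_odd \<Lambda> \<nu> U V W n) ?M \<le> ennreal c1 * weighted_dist \<phi> (pi_odd \<Lambda> \<nu> U V W n) ?M"
      and "ennreal c1 * weighted_dist \<phi> (pi_odd \<Lambda> \<nu> U V W n) ?M
        \<le> ennreal (c2 * \<rho> ^ (n - 1)) * weighted_dist \<phi> (pi_odd \<Lambda> \<nu> U V W 1) ?M"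
      by (rule o[THEN conjunct1], rule o[THEN conjunct2, THEN conjunct1], rule o[THEN conjunct2, THEN conjunct2])
  qed
qed

end
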